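(* Let $1\le k\le n-1$. There exist a smooth closed $T^n$-invariant submanifold $S_{n,k}\subset G_{n,k}$ of codimension $1$ and $T^n$-equivariant projections $\pi_0:S_{n,k}\to G_{n-1,k}$ and $\pi_1:S_{n,k}\to G_{n-1,k-1}$, and projections $\hat\pi_0:S_{n,k}/T^n\to G_{n-1,k}/T^{n-1}$ and $\hat\pi_1:S_{n,k}/T^n\to G_{n-1,k-1}/T^{n-1}$ (induced by $\pi_0$ and $\pi_1$), such that $$G_{n,k}/T^n = \big(S_{n,k}/T^n\times[0,1]\big)\cup_{\hat\pi_0}G_{n-1,k}/T^{n-1}\cup_{\hat\pi_1}G_{n-1,k-1}/T^{n-1},$$ where the right-hand side is the space obtained by gluing via the identifications $(s,0)\simeq\hat\pi_0(s)$ and $(s,1)\simeq\hat\pi_1(s)$ for $s\in S_{n,k}/T^n$, and equality means homeomorphism.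
   Context: $G_{n,k}$ is the Grassmann manifold of $k$-dimensional complex subspaces of $\mathbb{C}^n$ with the action of $T^n=(S^1)^n$ induced by the coordinatewise action on $\mathbb{C}^n$. Fix a coordinate index $q\in\{1,\dots,n\}$. $G_{n-1,k}$ is regarded as the $T^n$-invariant submanifold of $G_{n,k}$ of subspaces contained in the hyperplane $\{z_q=0\}$, and $G_{n-1,k-1}$ as the $T^n$-invariant submanifold of subspaces containing the coordinate vector $e_q$; on both, $T^n$ acts through the torus $T^{n-1}$ acting on $\{z_q=0\}\cong\mathbb{C}^{n-1}$. "Projection" means continuous surjection. *)

theory Defs
  imports "HOL-Analysis.Analysis"
begin

text \<open>Smoothness on open sets, in the normed-space setting of \<^const>\<open>frechet_derivative\<close>.\<close>

primrec Cr_on :: "nat \<Rightarrow> ('a::real_normed_vector \<Rightarrow> 'b::real_normed_vector) \<Rightarrow> 'a set \<Rightarrow> bool" where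
  "Cr_on 0 f U \<longleftrightarrow> continuous_on U f"
| "Cr_on (Suc r) f U \<longleftrightarrow> (\<forall>x\<in>U. f differentiable (at x)) \<and>
      (\<forall>v. Cr_on r (\<lambda>x. frechet_derivative f (at x) v) U)"

definition smooth_on :: "('a::real_normed_vector \<Rightarrow> 'b::real_normed_vector) \<Rightarrow> 'a set \<Rightarrow> bool" where
  "smooth_on f U \<longleftrightarrow> (\<forall>r. Cr_on r f U)"

text \<open>
  A manifold is given by its point set \<open>M\<close> and an atlas \<open>\<Phi>\<close> of inverse charts
  (local parametrizations), each of them an injection of the whole model space into \<open>M\<close>.
  The manifold topology is the one coherent with the parametrizations.
\<close>

definition atlas_topology :: "'a set \<Rightarrow> ('e::topological_space \<Rightarrow> 'a) set \<Rightarrow> 'a topology" where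
  "atlas_topology M \<Phi> = topology (\<lambda>U. U \<subseteq> M \<and> (\<forall>\<phi>\<in>\<Phi>. open (\<phi> -` U)))"

lemma openin_atlas_topology:
  "openin (atlas_topology M \<Phi>) U \<longleftrightarrow> U \<subseteq> M \<and> (\<forall>\<phi>\<in>\<Phi>. open (\<phi> -` U))"
proof -
  have "istopology (\<lambda>U. U \<subseteq> M \<and> (\<forall>\<phi>\<in>\<Phi>. open (\<phi> -` U)))"
    unfolding istopology_def by (auto simp: vimage_Union)
  then show ?thesis
    by (simp add: atlas_topology_def topology_inverse')
qed

text \<open>
  An embedded submanifold (without boundary) of codimension \<open>c\<close>: in every chart it is locally
  the common zero set of \<open>c\<close> smooth real functions whose differentials are linearly independent,
  i.e. jointly surjective onto the \<open>c\<close>-tuples of reals.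
\<close>

definition smooth_submanifold ::
  "'a set \<Rightarrow> ('e::euclidean_space \<Rightarrow> 'a) set \<Rightarrow> nat \<Rightarrow> 'a set \<Rightarrow> bool" where
  "smooth_submanifold M \<Phi> c S \<longleftrightarrow> S \<subseteq> M \<and>
    (\<forall>\<phi>\<in>\<Phi>. \<forall>a. \<phi> a \<in> S \<longrightarrow>
      (\<exists>U. \<exists>f :: nat \<Rightarrow> 'e \<Rightarrow> real. open U \<and> a \<in> U \<and>
        (\<forall>i<c. smooth_on (f i) U) \<and>
        (\<forall>x\<in>U. \<forall>y :: nat \<Rightarrow> real. \<exists>v. \<forall>i<c. frechet_derivative (f i) (at x) v = y i) \<and>
        (\<forall>x\<in>U. \<phi> x \<in> S \<longleftrightarrow> (\<forall>i<c. f i x = 0))))"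


definition grassmannian :: "nat \<Rightarrow> (complex^'n) set set" where
  "grassmannian k = {V. vec.subspace V \<and> vec.dim V = k}"

text \<open>
  The standard affine charts: \<open>\<sigma>\<close> and \<open>\<tau>\<close> enumerate \<open>k\<close> of the coordinates and the remaining
  \<open>m = n - k\<close> ones, and the \<open>m \<times> k\<close> matrix \<open>A\<close> parametrizes the \<open>k\<close>-plane that is the graph of
  \<open>A\<close>, as a linear map from the \<open>\<sigma>\<close>-coordinate plane to the \<open>\<tau>\<close>-coordinate plane.
  That \<open>\<sigma>\<close> and \<open>\<tau>\<close> split the coordinates is bijectivity of the map they induce on the sum type.
\<close>

definition graph_chart ::
  "('k::finite \<Rightarrow> 'n::finite) \<Rightarrow> ('m::finite \<Rightarrow> 'n) \<Rightarrow> complex^'k^'m \<Rightarrow> (complex^'n) set" where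
  "graph_chart \<sigma> \<tau> A = {x. (\<chi> j. x $ \<tau> j) = A *v (\<chi> i. x $ \<sigma> i)}"

definition grassmann_atlas ::
  "(complex^('k::finite)^('m::finite) \<Rightarrow> (complex^('n::finite)) set) set" where
  "grassmann_atlas = {graph_chart \<sigma> \<tau> | \<sigma> \<tau>. bij (case_sum \<sigma> \<tau>)}"

lemma graph_chart_in_grassmannian:
  fixes \<sigma> :: "'k::finite \<Rightarrow> 'n::finite" and \<tau> :: "'m::finite \<Rightarrow> 'n"
  assumes bij: "bij (case_sum \<sigma> \<tau>)"
  shows "graph_chart \<sigma> \<tau> A \<in> grassmannian CARD('k)"
proof -
  define h where "h = inv (case_sum \<sigma> \<tau>)"
  have h\<sigma>: "h (\<sigma> i) = Inl i" for i
    unfolding h_def using inv_f_f[OF bij_is_inj[OF bij], of "Inl i"] by simp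
  have h\<tau>: "h (\<tau> j) = Inr j" for j
    unfolding h_def using inv_f_f[OF bij_is_inj[OF bij], of "Inr j"] by simp
  have cover: "(\<exists>i. l = \<sigma> i) \<or> (\<exists>j. l = \<tau> j)" for l
  proof -
    obtain s where "l = case_sum \<sigma> \<tau> s"
      using bij_is_surj[OF bij] by blast
    then show ?thesis by (cases s) auto
  qed
  define g :: "complex^'k \<Rightarrow> complex^'n"
    where "g = (\<lambda>y. \<chi> l. case h l of Inl i \<Rightarrow> y $ i | Inr j \<Rightarrow> (A *v y) $ j)"
  have g\<sigma>: "g y $ \<sigma> i = y $ i" and g\<tau>: "g y $ \<tau> j = (A *v y) $ j" for y i j
    by (simp_all add: g_def h\<sigma> h\<tau>)
  have lin: "Vector_Spaces.linear (*s) (*s) g"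
    by unfold_locales
      (auto simp: g_def vec_eq_iff matrix_vector_mult_def sum.distrib algebra_simps
        sum_distrib_left split: sum.split)
  have inj: "inj g"
    by (metis (no_types, lifting) g\<sigma> injI vec_eq_iff)
  have img: "graph_chart \<sigma> \<tau> A = g ` UNIV"
  proof (intro set_eqI iffI)
    fix x assume x: "x \<in> graph_chart \<sigma> \<tau> A"
    have "x $ l = g (\<chi> i. x $ \<sigma> i) $ l" for l
      using cover[of l] x by (auto simp: graph_chart_def g\<sigma> g\<tau> vec_eq_iff)
    then show "x \<in> g ` UNIV"
      by (metis rangeI vec_eq_iff)
  next
    fix x assume "x \<in> g ` UNIV"
    then show "x \<in> graph_chart \<sigma> \<tau> A"
      by (auto simp: graph_chart_def g\<sigma> g\<tau> vec_eq_iff)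
  qed
  have "vec.subspace (g ` UNIV)"
    using lin by (intro vec.linear_subspace_image) auto
  moreover have "vec.dim (g ` UNIV) = CARD('k)"
    using vec.dim_image_eq[OF lin, of UNIV] inj vec_dim_card by (auto simp: vec.span_UNIV)
  ultimately show ?thesis
    by (simp add: grassmannian_def img)
qed

lemma grassmannian_eq_charts:
  assumes "CARD('n) = CARD('k) + CARD('m)"
  shows "grassmannian CARD('k) =
    (\<Union>\<phi>\<in>(grassmann_atlas ::
      (complex^('k::finite)^('m::finite) \<Rightarrow> (complex^('n::finite)) set) set). range \<phi>)"
    (is "_ = ?R")
proof
  show "?R \<subseteq> grassmannian CARD('k)"
    unfolding grassmann_atlas_def using graph_chart_in_grassmannian by blast
next
  show "grassmannian CARD('k) \<subseteq> ?R"
  proof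
    fix V :: "(complex^'n) set"
    assume "V \<in> grassmannian CARD('k)"
    then have sub: "vec.subspace V" and dim: "vec.dim V = CARD('k)"
      by (auto simp: grassmannian_def)
    obtain B where B: "B \<subseteq> V" "vec.independent B" "V \<subseteq> vec.span B" "card B = CARD('k)"
      using vec.basis_exists[of V] dim by metis
    have VB: "V = vec.span B"
      using B sub by (metis vec.span_subspace)
    obtain B' where B': "B \<subseteq> B'" "B' \<subseteq> B \<union> cart_basis" "vec.independent B'"
        "B \<union> cart_basis \<subseteq> vec.span B'"
      using vec.maximal_independent_subset_extend[of B "B \<union> cart_basis"] B(2) by blast
    define C where "C = B' - B"
    have C: "C \<subseteq> cart_basis" "B' = B \<union> C" "B \<inter> C = {}"
      using B' by (auto simp: C_def)
    have spanB': "vec.span B' = UNIV"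
    proof -
      have "vec.span cart_basis \<subseteq> vec.span (vec.span B')"
        using B'(4) by (intro vec.span_mono) auto
      then show ?thesis by (simp add: span_cart_basis vec.span_span top.extremum_uniqueI)
    qed
    have finB': "finite B'" using B'(3) vec.finiteI_independent by blast
    have "card B' = CARD('n)"
      using vec.dim_eq_card_independent[OF B'(3)] vec.dim_span[of B'] spanB' vec_dim_card
      by metis
    then have cardC: "card C = CARD('m)"
      using finB' C assms B(4) by (simp add: card_Un_disjoint)
    define J where "J = {j. axis j (1::complex) \<in> C}"
    have axJ: "C = (\<lambda>j. axis j 1) ` J"
      using C(1) by (auto simp: J_def cart_basis_def)
    have "inj_on (\<lambda>j. axis j (1::complex)) J"
      by (auto simp: inj_on_def axis_eq_axis)
    then have cardJ: "card J = CARD('m)"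
      using cardC axJ card_image by metis
    then have "card (- J) = CARD('k)"
      using assms by (simp add: Compl_eq_Diff_UNIV card_Diff_subset)
    then obtain \<sigma> :: "'k \<Rightarrow> 'n" where \<sigma>: "bij_betw \<sigma> UNIV (- J)"
      by (metis finite_class.finite_UNIV finite finite_same_card_bij)
    obtain \<tau> :: "'m \<Rightarrow> 'n" where \<tau>: "bij_betw \<tau> UNIV J"
      using cardJ by (metis finite_class.finite_UNIV finite finite_same_card_bij)
    have bij: "bij (case_sum \<sigma> \<tau>)"
    proof (rule bijI)
      have "\<sigma> i \<noteq> \<tau> j" for i j
        using \<sigma> \<tau> by (metis ComplD bij_betwE UNIV_I)
      then show "inj (case_sum \<sigma> \<tau>)"
        using \<sigma> \<tau> by (auto simp: inj_on_def bij_betw_def split: sum.splits; metis)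
      show "surj (case_sum \<sigma> \<tau>)"
      proof (intro equalityI subsetI)
        fix l :: 'n
        show "l \<in> range (case_sum \<sigma> \<tau>)"
        proof (cases "l \<in> J")
          case True
          then obtain j where "l = case_sum \<sigma> \<tau> (Inr j)"
            using \<tau> by (auto simp: bij_betw_def)
          then show ?thesis by blast
        next
          case False
          then have "l \<in> range \<sigma>" using \<sigma> by (simp add: bij_betw_def)
          then obtain i where "l = case_sum \<sigma> \<tau> (Inl i)"
            by auto
          then show ?thesis by blast
        qed
      qed auto
    qed
    define p :: "complex^'n \<Rightarrow> complex^'k" where "p = (\<lambda>x. \<chi> i. x $ \<sigma> i)"
    have lin: "Vector_Spaces.linear (*s) (*s) p"
      by unfold_locales (auto simp: p_def vec_eq_iff)
    have kerC: "p c = 0" if "c \<in> vec.span C" for c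
    proof -
      have "vec.subspace {x. p x = 0}"
        by (auto simp: p_def vec_eq_iff vec.subspace_def)
      moreover have "\<sigma> i \<notin> J" for i
        using \<sigma> by (metis ComplD bij_betwE UNIV_I)
      then have "C \<subseteq> {x. p x = 0}"
        by (auto simp: axJ p_def vec_eq_iff axis_def)
      ultimately show ?thesis
        using vec.span_minimal that by blast
    qed
    have pV: "y \<in> p ` V" for y
    proof -
      define x :: "complex^'n" where "x = (\<chi> l. y $ inv \<sigma> l)"
      have "inj \<sigma>" using \<sigma> by (simp add: bij_betw_def)
      then have px: "p x = y" by (simp add: p_def x_def)
      have "x \<in> vec.span (B \<union> C)" using spanB' C(2) by simp
      then obtain b c where bc: "x = b + c" "b \<in> vec.span B" "c \<in> vec.span C"
        by (auto simp: vec.span_Un)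
      have "p b = p x - p c" by (simp add: bc(1) p_def vec_eq_iff)
      then have "p b = y" using kerC[OF bc(3)] px by simp
      then show ?thesis using bc(2) VB by blast
    qed
    obtain g where g: "g ` UNIV \<subseteq> V" "Vector_Spaces.linear (*s) (*s) g" "\<forall>y\<in>p ` V. p (g y) = y"
      using vec.linear_exists_right_inverse_on[OF lin sub] by blast
    have pg: "g y $ \<sigma> i = y $ i" for y i
      using g(3) pV by (metis (no_types, lifting) p_def vec_lambda_beta)
    define A :: "complex^'k^'m" where "A = matrix (\<lambda>y. \<chi> j. g y $ \<tau> j)"
    have "Vector_Spaces.linear (*s) (*s) (\<lambda>y. \<chi> j. g y $ \<tau> j)"
    proof -
      interpret g: Vector_Spaces.linear "(*s)" "(*s)" g by (rule g(2))
      show ?thesis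
        by unfold_locales (auto simp: vec_eq_iff g.add g.scale)
    qed
    then have A: "A *v y = (\<chi> j. g y $ \<tau> j)" for y
      by (simp add: A_def matrix_works)
    have "graph_chart \<sigma> \<tau> A \<subseteq> V"
    proof
      fix x assume x: "x \<in> graph_chart \<sigma> \<tau> A"
      have "x $ l = g (p x) $ l" for l
      proof -
        obtain s where "l = case_sum \<sigma> \<tau> s"
          using bij_is_surj[OF bij] by blast
        then show ?thesis
          using x by (cases s) (auto simp: graph_chart_def A pg p_def vec_eq_iff)
      qed
      then have "x = g (p x)" by (simp add: vec_eq_iff)
      then show "x \<in> V" using g(1) by blast
    qed
    moreover have "vec.dim (graph_chart \<sigma> \<tau> A) = vec.dim V"
        "vec.subspace (graph_chart \<sigma> \<tau> A)"
      using graph_chart_in_grassmannian[OF bij, of A] dim by (auto simp: grassmannian_def)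
    ultimately have "graph_chart \<sigma> \<tau> A = V"
      using sub by (intro vec.subspace_dim_equal) auto
    then show "V \<in> ?R"
      using bij unfolding grassmann_atlas_def by blast
  qed
qed

definition torus :: "(complex^'n) set" where
  "torus = {t. \<forall>i. norm (t $ i) = 1}"

text \<open>
  The torus acting on the coordinate hyperplane \<open>{z. z $ q = 0}\<close>, as a coordinate subtorus.
  The product on \<^typ>\<open>complex^'n\<close> is the componentwise one.
\<close>

definition subtorus :: "'n \<Rightarrow> (complex^'n) set" where
  "subtorus q = {t \<in> torus. t $ q = 1}"

definition torus_act :: "complex^'n \<Rightarrow> (complex^'n) set \<Rightarrow> (complex^'n) set" where
  "torus_act t V = (\<lambda>z. t * z) ` V"

definition orbit :: "(complex^'n) set \<Rightarrow> (complex^'n) set \<Rightarrow> (complex^'n) set set" where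
  "orbit T V = (\<lambda>t. torus_act t V) ` T"

definition quotient_topology :: "'a topology \<Rightarrow> ('a \<Rightarrow> 'b) \<Rightarrow> 'b topology" where
  "quotient_topology X f =
    topology (\<lambda>U. U \<subseteq> f ` topspace X \<and> openin X {x \<in> topspace X. f x \<in> U})"

lemma quotient_map_quotient_topology: "quotient_map X (quotient_topology X f) f"
proof -
  have "istopology (\<lambda>U. U \<subseteq> f ` topspace X \<and> openin X {x \<in> topspace X. f x \<in> U})"
  proof -
    have "{x \<in> topspace X. f x \<in> S \<inter> T} =
        {x \<in> topspace X. f x \<in> S} \<inter> {x \<in> topspace X. f x \<in> T}" for S T
      by auto
    moreover have "{x \<in> topspace X. f x \<in> \<Union>K} = (\<Union>U\<in>K. {x \<in> topspace X. f x \<in> U})" for K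
      by auto
    ultimately show ?thesis
      unfolding istopology_def by (auto intro!: openin_Union)
  qed
  then have op: "openin (quotient_topology X f) U \<longleftrightarrow>
      U \<subseteq> f ` topspace X \<and> openin X {x \<in> topspace X. f x \<in> U}" for U
    by (simp add: quotient_topology_def topology_inverse')
  have "{x \<in> topspace X. f x \<in> f ` topspace X} = topspace X"
    by auto
  then have "topspace (quotient_topology X f) = f ` topspace X"
    using op by (metis openin_subset openin_topspace subset_antisym order_refl)
  then show ?thesis
    by (auto simp: quotient_map_def op)
qed

definition orbit_space ::
  "(complex^'n) set topology \<Rightarrow> (complex^'n) set \<Rightarrow> (complex^'n) set set topology" where
  "orbit_space X T = quotient_topology X (orbit T)"

definition disjoint_union_topology :: "'a topology \<Rightarrow> 'b topology \<Rightarrow> ('a + 'b) topology" where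
  "disjoint_union_topology X Y = topology (\<lambda>U. openin X (Inl -` U) \<and> openin Y (Inr -` U))"

lemma openin_disjoint_union_topology:
  "openin (disjoint_union_topology X Y) U \<longleftrightarrow> openin X (Inl -` U) \<and> openin Y (Inr -` U)"
proof -
  have "istopology (\<lambda>U. openin X (Inl -` U) \<and> openin Y (Inr -` U))"
    unfolding istopology_def by (auto simp: vimage_Union)
  then show ?thesis
    by (simp add: disjoint_union_topology_def topology_inverse')
qed

text \<open>
  The space \<open>(X \<times> [0,1]) \<union>\<^bsub>f\<^esub> Y \<union>\<^bsub>g\<^esub> Z\<close>, as the space of equivalence classes on the disjoint
  union under the equivalence relation generated by \<open>(s, 0) \<simeq> f s\<close> and \<open>(s, 1) \<simeq> g s\<close>.
\<close>

definition glue_rel ::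
  "'a set \<Rightarrow> ('a \<Rightarrow> 'b) \<Rightarrow> ('a \<Rightarrow> 'c) \<Rightarrow> 'a \<times> real + ('b + 'c) \<Rightarrow> 'a \<times> real + ('b + 'c) \<Rightarrow> bool" where
  "glue_rel P f g z w \<longleftrightarrow> (\<exists>s\<in>P.
      (z = Inl (s, 0) \<and> w = Inr (Inl (f s))) \<or> (z = Inl (s, 1) \<and> w = Inr (Inr (g s))))"

definition glued_space ::
  "'a topology \<Rightarrow> ('a \<Rightarrow> 'b) \<Rightarrow> 'b topology \<Rightarrow> ('a \<Rightarrow> 'c) \<Rightarrow> 'c topology
    \<Rightarrow> ('a \<times> real + ('b + 'c)) set topology" where
  "glued_space X f Y g Z =
    quotient_topology
      (disjoint_union_topology (prod_topology X (top_of_set {0..1}))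
        (disjoint_union_topology Y Z))
      (\<lambda>z. Collect (equivclp (glue_rel (topspace X) f g) z))"

definition projection :: "'a topology \<Rightarrow> 'b topology \<Rightarrow> ('a \<Rightarrow> 'b) \<Rightarrow> bool" where
  "projection X Y f \<longleftrightarrow> continuous_map X Y f \<and> f ` topspace X = topspace Y"

definition torus_equivariant_on ::
  "(complex^'n) set set \<Rightarrow> ((complex^'n) set \<Rightarrow> (complex^'n) set) \<Rightarrow> bool" where
  "torus_equivariant_on S f \<longleftrightarrow>
    (\<forall>t\<in>torus. \<forall>V\<in>S. f (torus_act t V) = torus_act t (f V))"

end

theory Submission
  imports Defs
begin

text \<open>
  Let \<open>p\<close> be the orthogonal projection of \<open>e\<^sub>q\<close> to \<open>V\<close>. The \<open>q\<close>-th moment coordinate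
  \<open>\<mu>(V) = \<bar>p\<bar>\<^sup>2 \<in> [0,1]\<close> is torus invariant, vanishes exactly on the subspaces of the hyperplane and
  equals 1 exactly on the subspaces containing \<open>e\<^sub>q\<close>. Scaling the coordinate \<open>q\<close> by \<open>c > 0\<close> commutes
  with the torus, and strictly increases \<open>\<mu>\<close> in \<open>c\<close> from 0 to 1 wherever \<open>0 < \<mu> < 1\<close>; so
  \<open>S = {\<mu> = 1/2}\<close> is a smooth hypersurface, and the scaling orbits with their limits give an
  equivariant map \<open>S \<times> [0,1] \<rightarrow> G\<^sub>n\<^sub>,\<^sub>k\<close> which is a bijection onto \<open>{0 < \<mu> < 1}\<close> on \<open>S \<times> (0,1)\<close> and
  maps \<open>S\<close> onto the two extremal sets at the ends. Compactness turns this into the homeomorphism.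
\<close>

section \<open>Calculus of smooth functions\<close>

text \<open>Two obstacles shape the proof. The scaling degenerates as c tends to infinity. With c =
  t / (1 - t) it is therefore composed with a linear automorphism of V that contracts the direction
  of p by the factor 1 - t and so cancels the pole; what results is a linear map depending affinely
  on t, without singularity on [0,1]. The topology of the Grassmannian is given by charts that
  parametrize it, which test maps out of it, whereas the flow is a map into it. Sending a subspace
  to the matrix of its orthogonal projection is continuous and injective, compactness makes it an
  embedding, and the projection to a flowed subspace has an explicit formula, rational in t and in
  the entries of the old matrix and their conjugates. The level 1/2 is the symmetric choice: there u
  = 2p - e_q is a unit vector orthogonal to e_q, and a flow line turns u into e_q while fixing the
  rest of V. The bounds on k make the end maps surjective: a subspace of the hyperplane must contain
  a unit vector that can be tilted towards e_q, and a subspace containing e_q must have a unit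
  normal vector towards which e_q can be tilted.\<close>

lemma Cr_on_cong:
  assumes "open U" "\<And>x. x \<in> U \<Longrightarrow> f x = g x" "Cr_on r f U"
  shows "Cr_on r g U"
  using assms(2,3)
proof (induction r arbitrary: f g)
  case 0
  then show ?case using continuous_on_cong by (metis Cr_on.simps(1))
next
  case (Suc r)
  have d: "f differentiable (at x)" if "x \<in> U" for x using Suc.prems that by simp
  have "g differentiable (at x)" if "x \<in> U" for x
  proof -
    obtain D where "(f has_derivative D) (at x)"
      using d[OF \<open>x \<in> U\<close>] by (meson differentiable_def)
    then have "(g has_derivative D) (at x)"
      by (rule has_derivative_transform_within_open[OF _ assms(1) that Suc.prems(1)])
    then show ?thesis by (auto simp: differentiable_def)
  qed
  moreover have "Cr_on r (\<lambda>x. frechet_derivative g (at x) v) U" for v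
  proof (rule Suc.IH)
    show "frechet_derivative f (at x) v = frechet_derivative g (at x) v" if "x \<in> U" for x
      using frechet_derivative_transform_within_open[OF d[OF that] assms(1) that] Suc.prems(1)
      by metis
    show "Cr_on r (\<lambda>x. frechet_derivative f (at x) v) U" using Suc.prems by simp
  qed
  ultimately show ?case by simp
qed

text \<open>\<open>frechet_derivative\<close> is a choice operator. Uniqueness of derivatives
  identifies it on an open set with any explicit formula, so each closure property below becomes an
  induction on \<open>r\<close> with the usual differentiation rule as its step.\<close>

lemma Cr_on_SucI:
  assumes "open U" "\<And>x. x \<in> U \<Longrightarrow> (f has_derivative f' x) (at x)"
    and "\<And>v. Cr_on r (\<lambda>x. f' x v) U"
  shows "Cr_on (Suc r) f U"
proof -
  have "Cr_on r (\<lambda>x. frechet_derivative f (at x) v) U" for v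
    by (rule Cr_on_cong[OF assms(1) _ assms(3)[of v]]) (metis assms(2) frechet_derivative_at)
  then show ?thesis using assms(2) by (auto simp: differentiable_def)
qed

lemma Cr_on_has_derivative:
  assumes "Cr_on (Suc r) f U" "x \<in> U"
  shows "(f has_derivative frechet_derivative f (at x)) (at x)"
  using assms frechet_derivative_works Cr_on.simps(2) by blast

lemma Cr_on_continuous_on: "Cr_on r f U \<Longrightarrow> continuous_on U f"
  by (cases r) (auto intro!: continuous_at_imp_continuous_on differentiable_imp_continuous_within)

lemma Cr_on_Suc_imp: "Cr_on (Suc r) f U \<Longrightarrow> Cr_on r f U"
proof (induction r arbitrary: f)
  case 0
  then show ?case using Cr_on_continuous_on Cr_on.simps(1) by metis
next
  case (Suc r)
  then show ?case by (metis Cr_on.simps(2))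
qed

lemma Cr_on_const: "open U \<Longrightarrow> Cr_on r (\<lambda>x. c) U"
proof (induction r arbitrary: c)
  case (Suc r)
  then show ?case by (intro Cr_on_SucI[where f' = "\<lambda>x v. 0"]) auto
qed simp

lemma Cr_on_bounded_linear:
  assumes "bounded_linear h" "open U" "Cr_on r f U"
  shows "Cr_on r (\<lambda>x. h (f x)) U"
  using assms(3)
proof (induction r arbitrary: f)
  case 0
  then show ?case using assms(1) bounded_linear.continuous_on by auto
next
  case (Suc r)
  show ?case
  proof (rule Cr_on_SucI[OF assms(2)])
    show "((\<lambda>x. h (f x)) has_derivative (\<lambda>v. h (frechet_derivative f (at x) v))) (at x)"
      if "x \<in> U" for x
      using bounded_linear.has_derivative[OF assms(1) Cr_on_has_derivative[OF Suc.prems that]] .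
    show "Cr_on r (\<lambda>x. h (frechet_derivative f (at x) v)) U" for v
      using Suc by simp
  qed
qed

lemma Cr_on_add:
  assumes "open U" "Cr_on r f U" "Cr_on r g U"
  shows "Cr_on r (\<lambda>x. f x + g x) U"
  using assms(2,3)
proof (induction r arbitrary: f g)
  case 0
  then show ?case by (auto intro: continuous_on_add)
next
  case (Suc r)
  show ?case
  proof (rule Cr_on_SucI[OF assms(1)])
    show "((\<lambda>x. f x + g x) has_derivative
        (\<lambda>v. frechet_derivative f (at x) v + frechet_derivative g (at x) v)) (at x)"
      if "x \<in> U" for x
      using Suc.prems that by (intro has_derivative_add Cr_on_has_derivative)
    show "Cr_on r (\<lambda>x. frechet_derivative f (at x) v + frechet_derivative g (at x) v) U" for v
      using Suc by simp
  qed
qed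

text \<open>The product rule keeps undifferentiated factors, so the induction hypothesis also needs
  \<open>f\<close> and \<open>g\<close> themselves one order lower; \<open>Cr_on_Suc_imp\<close>
  provides this.\<close>

lemma Cr_on_mult:
  fixes f g :: "'a::real_normed_vector \<Rightarrow> 'b::real_normed_algebra"
  assumes "open U" "Cr_on r f U" "Cr_on r g U"
  shows "Cr_on r (\<lambda>x. f x * g x) U"
  using assms(2,3)
proof (induction r arbitrary: f g)
  case 0
  then show ?case by (auto intro: continuous_on_mult)
next
  case (Suc r)
  show ?case
  proof (rule Cr_on_SucI[OF assms(1)])
    show "((\<lambda>x. f x * g x) has_derivative
        (\<lambda>v. f x * frechet_derivative g (at x) v + frechet_derivative f (at x) v * g x)) (at x)"
      if "x \<in> U" for x
      using Suc.prems that by (intro has_derivative_mult Cr_on_has_derivative)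
    show "Cr_on r (\<lambda>x. f x * frechet_derivative g (at x) v +
        frechet_derivative f (at x) v * g x) U" for v
      by (rule Cr_on_add[OF assms(1)]; rule Suc.IH)
        (use Suc.prems Cr_on_Suc_imp[OF Suc.prems(1)] Cr_on_Suc_imp[OF Suc.prems(2)] in auto)
  qed
qed

text \<open>Bootstrapping: the derivative of 1/f is a polynomial in 1/f and the derivative of f, and
  the induction hypothesis already makes 1/f of order \<open>r\<close>.\<close>

lemma Cr_on_inverse:
  fixes f :: "'a::real_normed_vector \<Rightarrow> 'b::real_normed_field"
  assumes "open U" "Cr_on r f U" "\<And>x. x \<in> U \<Longrightarrow> f x \<noteq> 0"
  shows "Cr_on r (\<lambda>x. inverse (f x)) U"
  using assms(2,3)
proof (induction r)
  case 0
  then show ?case by (auto intro: continuous_on_inverse)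
next
  case (Suc r)
  show ?case
  proof (rule Cr_on_SucI[OF assms(1)])
    show "((\<lambda>x. inverse (f x)) has_derivative
        (\<lambda>v. -1 * (inverse (f x) * frechet_derivative f (at x) v * inverse (f x)))) (at x)"
      if "x \<in> U" for x
      using Deriv.has_derivative_inverse[OF Suc.prems(2)[OF that] Cr_on_has_derivative[OF Suc.prems(1) that]]
      by simp
    have inv: "Cr_on r (\<lambda>x. inverse (f x)) U"
      using Suc Cr_on_Suc_imp by blast
    show "Cr_on r (\<lambda>x. -1 * (inverse (f x) * frechet_derivative f (at x) v * inverse (f x))) U" for v
      by (rule Cr_on_mult[OF assms(1) Cr_on_const[OF assms(1)]
            Cr_on_mult[OF assms(1) Cr_on_mult[OF assms(1)]]]) (use Suc.prems inv in auto)
  qed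
qed

lemma smooth_on_const: "open U \<Longrightarrow> smooth_on (\<lambda>x. c) U"
  by (simp add: smooth_on_def Cr_on_const)

lemma smooth_on_id: "open U \<Longrightarrow> smooth_on (\<lambda>x. x) U"
  unfolding smooth_on_def
proof
  fix r assume U: "open U"
  show "Cr_on r (\<lambda>x. x) U"
  proof (cases r)
    case (Suc r')
    then show ?thesis
      using Cr_on_SucI[OF U, where f = "\<lambda>x. x" and f' = "\<lambda>x v. v"] Cr_on_const[OF U] by auto
  qed simp
qed

lemma smooth_on_bounded_linear:
  "bounded_linear h \<Longrightarrow> open U \<Longrightarrow> smooth_on f U \<Longrightarrow> smooth_on (\<lambda>x. h (f x)) U"
  unfolding smooth_on_def using Cr_on_bounded_linear by metis

lemma smooth_on_add:
  "open U \<Longrightarrow> smooth_on f U \<Longrightarrow> smooth_on g U \<Longrightarrow> smooth_on (\<lambda>x. f x + g x) U"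
  by (simp add: smooth_on_def Cr_on_add)

lemma smooth_on_mult:
  fixes f g :: "'a::real_normed_vector \<Rightarrow> 'b::real_normed_algebra"
  shows "open U \<Longrightarrow> smooth_on f U \<Longrightarrow> smooth_on g U \<Longrightarrow> smooth_on (\<lambda>x. f x * g x) U"
  by (simp add: smooth_on_def Cr_on_mult)

lemma smooth_on_divide:
  fixes f g :: "'a::real_normed_vector \<Rightarrow> 'b::real_normed_field"
  assumes "open U" "smooth_on f U" "smooth_on g U" "\<And>x. x \<in> U \<Longrightarrow> g x \<noteq> 0"
  shows "smooth_on (\<lambda>x. f x / g x) U"
  using Cr_on_mult[OF assms(1) _ Cr_on_inverse[OF assms(1)]] assms
  unfolding smooth_on_def divide_inverse by metis

lemma smooth_on_sum:
  assumes "open U" "\<And>i. i \<in> I \<Longrightarrow> smooth_on (f i) U"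
  shows "smooth_on (\<lambda>x. \<Sum>i\<in>I. f i x) U"
  using assms(2)
proof (induction I rule: infinite_finite_induct)
  case (insert i I)
  then show ?case by (simp add: smooth_on_add[OF assms(1)])
qed (simp_all add: smooth_on_const[OF assms(1)])

lemma smooth_on_prod:
  fixes f :: "'i \<Rightarrow> 'a::real_normed_vector \<Rightarrow> 'b::real_normed_field"
  assumes "open U" "\<And>i. i \<in> I \<Longrightarrow> smooth_on (f i) U"
  shows "smooth_on (\<lambda>x. \<Prod>i\<in>I. f i x) U"
  using assms(2)
proof (induction I rule: infinite_finite_induct)
  case (insert i I)
  then show ?case by (simp add: smooth_on_mult[OF assms(1)])
qed (simp_all add: smooth_on_const[OF assms(1)])

lemma smooth_on_det:
  fixes B :: "'a::real_normed_vector \<Rightarrow> complex^'k::finite^'k"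
  assumes "open U" "\<And>i j. smooth_on (\<lambda>x. B x $ i $ j) U"
  shows "smooth_on (\<lambda>x. det (B x)) U"
  unfolding det_def
  by (intro smooth_on_sum smooth_on_mult smooth_on_prod smooth_on_const assms)

lemma smooth_on_imp_continuous_on: "smooth_on f U \<Longrightarrow> continuous_on U f"
  using Cr_on_continuous_on smooth_on_def by metis

section \<open>Quotient maps and gluing\<close>

lemma quotient_topology_cong:
  assumes "\<And>x. x \<in> topspace X \<Longrightarrow> f x = g x"
  shows "quotient_topology X f = quotient_topology X g"
proof -
  have "f ` topspace X = g ` topspace X"
    using assms by (intro image_cong) auto
  moreover have "{x \<in> topspace X. f x \<in> U} = {x \<in> topspace X. g x \<in> U}" for U
    using assms by auto
  ultimately show ?thesis by (simp add: quotient_topology_def)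
qed

lemma topspace_quotient_topology: "topspace (quotient_topology X f) = f ` topspace X"
  using quotient_map_quotient_topology[of X f] by (simp add: quotient_map_def)

text \<open>Each map is constant on the fibres of the other, so both descend, and the descended maps
  are mutually inverse. The orbit space and the glued space are compared this way, as quotients of
  one disjoint union.\<close>

lemma quotient_maps_homeomorphic:
  assumes f: "quotient_map X Y f" and g: "quotient_map X Z g"
    and eq: "\<And>x y. x \<in> topspace X \<Longrightarrow> y \<in> topspace X \<Longrightarrow> f x = f y \<longleftrightarrow> g x = g y"
  shows "Y homeomorphic_space Z"
proof -
  obtain u where u: "continuous_map Y Z u" "\<And>x. x \<in> topspace X \<Longrightarrow> u (f x) = g x"
    using quotient_map_lift_exists[OF f quotient_imp_continuous_map[OF g]] eq by metis
  obtain v where v: "continuous_map Z Y v" "\<And>x. x \<in> topspace X \<Longrightarrow> v (g x) = f x"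
    using quotient_map_lift_exists[OF g quotient_imp_continuous_map[OF f]] eq by metis
  have "topspace Y = f ` topspace X" "topspace Z = g ` topspace X"
    using f g by (auto simp: quotient_map_def)
  then have "homeomorphic_maps Y Z u v"
    using u v by (auto simp: homeomorphic_maps_def)
  then show ?thesis unfolding homeomorphic_space_def by blast
qed

lemma topspace_disjoint_union_topology:
  "topspace (disjoint_union_topology X Y) = Inl ` topspace X \<union> Inr ` topspace Y" (is "_ = ?R")
proof
  have "openin (disjoint_union_topology X Y) ?R"
  proof -
    have "Inl -` ?R = topspace X" "Inr -` ?R = topspace Y" by auto
    then show ?thesis by (simp add: openin_disjoint_union_topology)
  qed
  then show "?R \<subseteq> topspace (disjoint_union_topology X Y)" by (rule openin_subset)
  have "openin (disjoint_union_topology X Y) (topspace (disjoint_union_topology X Y))" by simp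
  then have "Inl -` topspace (disjoint_union_topology X Y) \<subseteq> topspace X"
    "Inr -` topspace (disjoint_union_topology X Y) \<subseteq> topspace Y"
    unfolding openin_disjoint_union_topology by (auto dest: openin_subset)
  then show "topspace (disjoint_union_topology X Y) \<subseteq> ?R"
  proof (intro subsetI)
    fix z assume "Inl -` topspace (disjoint_union_topology X Y) \<subseteq> topspace X"
      "Inr -` topspace (disjoint_union_topology X Y) \<subseteq> topspace Y"
      "z \<in> topspace (disjoint_union_topology X Y)"
    then show "z \<in> ?R" by (cases z) auto
  qed
qed

lemma continuous_map_Inl: "continuous_map X (disjoint_union_topology X Y) Inl"
proof -
  have "{x \<in> topspace X. Inl x \<in> U} = Inl -` U" if "openin X (Inl -` U)" for U :: "('a + 'b) set"
    using openin_subset[OF that] by auto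
  then show ?thesis
    by (auto simp: continuous_map_def topspace_disjoint_union_topology openin_disjoint_union_topology)
qed

lemma continuous_map_Inr: "continuous_map Y (disjoint_union_topology X Y) Inr"
proof -
  have "{y \<in> topspace Y. Inr y \<in> U} = Inr -` U" if "openin Y (Inr -` U)" for U :: "('b + 'a) set"
    using openin_subset[OF that] by auto
  then show ?thesis
    by (auto simp: continuous_map_def topspace_disjoint_union_topology openin_disjoint_union_topology)
qed

lemma compact_space_disjoint_union:
  assumes "compact_space X" "compact_space Y"
  shows "compact_space (disjoint_union_topology X Y)"
  unfolding compact_space_def topspace_disjoint_union_topology
  using assms[unfolded compact_space_def]
  by (intro compactin_Un image_compactin[OF _ continuous_map_Inl] image_compactin[OF _ continuous_map_Inr])

lemma continuous_map_case_sum: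
  assumes "continuous_map X Z f" "continuous_map Y Z g"
  shows "continuous_map (disjoint_union_topology X Y) Z (case_sum f g)"
  unfolding continuous_map_def
proof (intro conjI allI impI)
  show "case_sum f g \<in> topspace (disjoint_union_topology X Y) \<rightarrow> topspace Z"
    using assms by (auto simp: continuous_map_def topspace_disjoint_union_topology)
  fix U assume U: "openin Z U"
  have "Inl -` {x \<in> topspace (disjoint_union_topology X Y). case_sum f g x \<in> U} =
      {x \<in> topspace X. f x \<in> U}"
    "Inr -` {x \<in> topspace (disjoint_union_topology X Y). case_sum f g x \<in> U} =
      {x \<in> topspace Y. g x \<in> U}"
    by (auto simp: topspace_disjoint_union_topology)
  then show "openin (disjoint_union_topology X Y)
      {x \<in> topspace (disjoint_union_topology X Y). case_sum f g x \<in> U}"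
    using U assms by (simp add: openin_disjoint_union_topology continuous_map_def)
qed

lemma quotient_map_map_sum:
  assumes f: "quotient_map X X' f" and g: "quotient_map Y Y' g"
  shows "quotient_map (disjoint_union_topology X Y) (disjoint_union_topology X' Y') (map_sum f g)"
  unfolding quotient_map_def
proof (intro conjI allI impI)
  show "map_sum f g ` topspace (disjoint_union_topology X Y) = topspace (disjoint_union_topology X' Y')"
  proof -
    have "topspace X' = f ` topspace X" "topspace Y' = g ` topspace Y"
      using f g by (auto simp: quotient_map_def)
    then show ?thesis
      by (simp add: topspace_disjoint_union_topology image_Un image_image)
  qed
  fix U assume U: "U \<subseteq> topspace (disjoint_union_topology X' Y')"
  then have sub: "Inl -` U \<subseteq> topspace X'" "Inr -` U \<subseteq> topspace Y'"
    by (auto simp: topspace_disjoint_union_topology)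
  have "Inl -` {x \<in> topspace (disjoint_union_topology X Y). map_sum f g x \<in> U} =
      {x \<in> topspace X. f x \<in> Inl -` U}"
    "Inr -` {x \<in> topspace (disjoint_union_topology X Y). map_sum f g x \<in> U} =
      {x \<in> topspace Y. g x \<in> Inr -` U}"
    by (auto simp: topspace_disjoint_union_topology)
  moreover have "openin X {x \<in> topspace X. f x \<in> Inl -` U} = openin X' (Inl -` U)"
    "openin Y {x \<in> topspace Y. g x \<in> Inr -` U} = openin Y' (Inr -` U)"
    using f g sub unfolding quotient_map_def by blast+
  ultimately show "openin (disjoint_union_topology X Y)
       {x \<in> topspace (disjoint_union_topology X Y). map_sum f g x \<in> U} =
      openin (disjoint_union_topology X' Y') U"
    by (simp only: openin_disjoint_union_topology)
qed

text \<open>Serves for maps into the Grassmannian, whose continuity is tested in matrix space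
  instead of in charts.\<close>

lemma continuous_map_into_embedding:
  assumes e: "embedding_map Y Z e" and c: "continuous_map X Z (e \<circ> f)"
    and f: "f \<in> topspace X \<rightarrow> topspace Y"
  shows "continuous_map X Y f"
proof -
  obtain h where h: "homeomorphic_maps Y (subtopology Z (e ` topspace Y)) e h"
    using e unfolding embedding_map_def homeomorphic_map_maps by blast
  have "continuous_map X (subtopology Z (e ` topspace Y)) (e \<circ> f)"
    using c f by (auto simp: continuous_map_in_subtopology)
  then have "continuous_map X Y (h \<circ> (e \<circ> f))"
    using h continuous_map_compose homeomorphic_maps_def by blast
  then show ?thesis
    by (rule continuous_map_eq) (use h f in \<open>auto simp: homeomorphic_maps_def Pi_iff\<close>)
qed

section \<open>Orthogonal projections in complex coordinate space\<close>

text \<open>The Hermitian form, linear in the first argument; \<open>inner\<close> on this type is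
  only its real part.\<close>

definition hip :: "complex^'n \<Rightarrow> complex^'n \<Rightarrow> complex" where
  "hip x y = (\<Sum>i\<in>UNIV. x $ i * cnj (y $ i))"

lemma hip_add_left: "hip (x + y) z = hip x z + hip y z"
  and hip_diff_left: "hip (x - y) z = hip x z - hip y z"
  and hip_scale_left: "hip (c *s x) z = c * hip x z"
  and hip_zero_left: "hip 0 z = 0"
  by (simp_all add: hip_def algebra_simps sum.distrib sum_subtractf sum_distrib_left)

lemma hip_add_right: "hip z (x + y) = hip z x + hip z y"
  and hip_diff_right: "hip z (x - y) = hip z x - hip z y"
  and hip_scale_right: "hip z (c *s x) = cnj c * hip z x"
  and hip_zero_right: "hip z 0 = 0"
  by (simp_all add: hip_def algebra_simps sum.distrib sum_subtractf sum_distrib_left)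

lemmas hip_simps = hip_add_left hip_diff_left hip_scale_left hip_zero_left
  hip_add_right hip_diff_right hip_scale_right hip_zero_right

lemma hip_sum_right: "hip z (\<Sum>i\<in>I. f i) = (\<Sum>i\<in>I. hip z (f i))"
  by (induction I rule: infinite_finite_induct) (simp_all add: hip_simps)

lemma cnj_hip: "cnj (hip x y) = hip y x"
  by (simp add: hip_def mult.commute)

lemma hip_axis_right: "hip x (axis j 1) = x $ j"
proof -
  have "x $ i * cnj (axis j 1 $ i) = (if i = j then x $ j else 0)" for i
    by (simp add: axis_def)
  then show ?thesis by (simp add: hip_def)
qed

lemma hip_axis_left: "hip (axis j 1) x = cnj (x $ j)"
  using cnj_hip[of x "axis j 1"] by (simp add: hip_axis_right)

lemma hip_self: "hip x x = complex_of_real (\<Sum>i\<in>UNIV. (cmod (x $ i))\<^sup>2)"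
  unfolding hip_def of_real_sum
  by (intro sum.cong) (simp_all only: complex_norm_square)

lemma hip_self_Re: "hip x x = complex_of_real (Re (hip x x))" and hip_self_nonneg: "0 \<le> Re (hip x x)"
  by (simp_all add: hip_self sum_nonneg)

lemma hip_self_eq_0: "hip x x = 0 \<longleftrightarrow> x = 0"
proof
  assume "hip x x = 0"
  then have "(\<Sum>i\<in>UNIV. (cmod (x $ i))\<^sup>2) = 0"
    unfolding hip_self of_real_eq_0_iff .
  then have "(cmod (x $ i))\<^sup>2 = 0" for i
    using sum_nonneg_eq_0_iff[of UNIV "\<lambda>i. (cmod (x $ i))\<^sup>2"] by simp
  then show "x = 0" by (simp add: vec_eq_iff)
qed (simp add: hip_simps)

lemma hip_normalize:
  assumes "x \<noteq> 0"
  obtains c where "hip (c *s x) (c *s x) = 1"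
proof
  define r where "r = Re (hip x x)"
  have "r > 0"
    using assms hip_self_eq_0 hip_self_Re hip_self_nonneg unfolding r_def
    by (metis less_eq_real_def of_real_0)
  then have "complex_of_real (1 / sqrt r) * (complex_of_real (1 / sqrt r) * complex_of_real r) = 1"
    by (simp flip: of_real_mult)
  moreover have "hip x x = complex_of_real r"
    using hip_self_Re[of x] by (simp only: r_def)
  ultimately show "hip (complex_of_real (1 / sqrt r) *s x) (complex_of_real (1 / sqrt r) *s x) = 1"
    by (simp add: hip_simps)
qed

text \<open>The condition says that \<open>x - y\<close> is orthogonal to \<open>V\<close>; as an
  equality of functionals on \<open>V\<close> it can be used directly for rewriting.\<close>

definition is_oproj :: "(complex^'n) set \<Rightarrow> complex^'n \<Rightarrow> complex^'n \<Rightarrow> bool" where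
  "is_oproj V x y \<longleftrightarrow> y \<in> V \<and> (\<forall>w\<in>V. hip w x = hip w y)"

definition oproj :: "(complex^'n) set \<Rightarrow> complex^'n \<Rightarrow> complex^'n" where
  "oproj V x = (THE y. is_oproj V x y)"

lemma is_oproj_unique:
  assumes "vec.subspace V" "is_oproj V x y" "is_oproj V x z"
  shows "y = z"
proof -
  have "y - z \<in> V" using assms vec.subspace_diff by (auto simp: is_oproj_def)
  then have "hip (y - z) (y - z) = 0"
    using assms unfolding is_oproj_def by (simp add: hip_diff_right)
  then show ?thesis by (simp add: hip_self_eq_0)
qed

text \<open>Real orthogonality to a complex subspace is Hermitian orthogonality, because the subspace is
  closed under multiplication by the imaginary unit.\<close>

lemma is_oproj_exists:
  assumes V: "vec.subspace V"
  shows "\<exists>y. is_oproj V x y"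
proof -
  have sc: "r *\<^sub>R w = complex_of_real r *s w" for r and w :: "complex^'n"
    unfolding vec_eq_iff vector_scaleR_component vector_smult_component
    by (simp add: scaleR_conv_of_real)
  have "subspace V"
    using V unfolding subspace_def vec.subspace_def sc by blast
  then have span: "span V = V" by (simp add: span_eq_iff)
  obtain y z where yz: "y \<in> span V" "\<And>w. w \<in> span V \<Longrightarrow> orthogonal z w" "x = y + z"
    using orthogonal_subspace_decomp_exists[of V x] by blast
  have re: "inner a b = Re (hip a b)" for a b :: "complex^'n"
    by (simp add: inner_vec_def hip_def inner_complex_def)
  have "hip w z = 0" if "w \<in> V" for w
  proof (rule complex_eqI)
    show "Re (hip w z) = Re 0"
      using yz(2) that span by (metis inner_commute orthogonal_def re zero_complex.simps(1))
    have "\<i> *s w \<in> V" using that V by (simp add: vec.subspace_scale)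
    then have "Re (hip (\<i> *s w) z) = 0"
      using yz(2) span by (metis inner_commute orthogonal_def re)
    then show "Im (hip w z) = Im 0" by (simp add: hip_scale_left)
  qed
  then have "is_oproj V x y"
    using yz span by (auto simp: is_oproj_def hip_simps)
  then show ?thesis by blast
qed

lemma is_oproj_oproj: "vec.subspace V \<Longrightarrow> is_oproj V x (oproj V x)"
  unfolding oproj_def using is_oproj_exists is_oproj_unique by (metis (no_types, lifting) theI)

lemma oproj_eqI:
  "vec.subspace V \<Longrightarrow> y \<in> V \<Longrightarrow> (\<And>w. w \<in> V \<Longrightarrow> hip w x = hip w y) \<Longrightarrow> oproj V x = y"
  using is_oproj_unique is_oproj_oproj by (metis is_oproj_def)

lemma oproj_in: "vec.subspace V \<Longrightarrow> oproj V x \<in> V"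
  using is_oproj_oproj is_oproj_def by blast

lemma hip_oproj: "vec.subspace V \<Longrightarrow> w \<in> V \<Longrightarrow> hip w (oproj V x) = hip w x"
  using is_oproj_oproj is_oproj_def by metis

lemma oproj_idem: "vec.subspace V \<Longrightarrow> v \<in> V \<Longrightarrow> oproj V v = v"
  by (rule oproj_eqI) auto

text \<open>The projection is linear in the vector, so its values on the coordinate vectors, the
  columns of its matrix, determine it.\<close>

lemma oproj_sum_axis:
  assumes V: "vec.subspace V"
  shows "oproj V x = (\<Sum>j\<in>UNIV. x $ j *s oproj V (axis j 1))"
proof (rule oproj_eqI[OF V])
  show "(\<Sum>j\<in>UNIV. x $ j *s oproj V (axis j 1)) \<in> V"
    by (intro vec.subspace_sum vec.subspace_scale oproj_in V)
  show "hip w x = hip w (\<Sum>j\<in>UNIV. x $ j *s oproj V (axis j 1))" if "w \<in> V" for w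
    using that V by (simp add: hip_sum_right hip_scale_right hip_oproj hip_axis_right)
      (simp add: hip_def mult.commute)
qed

definition proj_matrix :: "(complex^'n) set \<Rightarrow> complex^'n^'n" where
  "proj_matrix V = (\<chi> l j. oproj V (axis j 1) $ l)"

text \<open>A subspace is recovered as the fixed set of its projection.\<close>

lemma proj_matrix_inj:
  assumes "vec.subspace V" "vec.subspace W" "proj_matrix V = proj_matrix W"
  shows "V = W"
proof -
  have "oproj V (axis j 1) = oproj W (axis j 1)" for j
    using assms(3) by (simp add: proj_matrix_def vec_eq_iff)
  then have "oproj V x = oproj W x" for x
    using assms(1,2) by (simp only: oproj_sum_axis[of V x] oproj_sum_axis[of W x])
  then show ?thesis
    using assms(1,2) oproj_idem oproj_in by (metis subsetI subset_antisym)
qed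

section \<open>Coordinate scalings\<close>

lemma linear_vmult: "Vector_Spaces.linear (*s) (*s) (\<lambda>z. d * z :: complex^'n)"
  by unfold_locales (auto simp: vec_eq_iff algebra_simps)

text \<open>Injectivity is asked on \<open>V\<close> only, because the flow at time 0 annihilates
  \<open>axis q 1\<close> and is singular on the whole space.\<close>

lemma grassmannian_linear_image:
  fixes h :: "complex^'n::finite \<Rightarrow> complex^'n"
  assumes lin: "Vector_Spaces.linear (*s) (*s) h" and V: "V \<in> grassmannian k"
    and inj: "\<And>v. v \<in> V \<Longrightarrow> h v = 0 \<Longrightarrow> v = 0"
  shows "h ` V \<in> grassmannian k"
proof -
  interpret h: Vector_Spaces.linear "(*s)" "(*s)" h by (rule lin)
  have sub: "vec.subspace V" and dim: "vec.dim V = k" using V by (auto simp: grassmannian_def)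
  have "inj_on h (vec.span V)"
    unfolding vec.span_eq_iff[THEN iffD2, OF sub] using h.inj_on_iff_eq_0[OF sub] inj by blast
  then have "vec.dim (h ` V) = k" using vec.dim_image_eq[OF lin] dim by simp
  moreover have "vec.subspace (h ` V)"
    using lin sub by (rule vec.linear_subspace_image)
  ultimately show ?thesis by (simp add: grassmannian_def)
qed

lemma torus_act_grassmannian:
  assumes "V \<in> grassmannian k" "\<And>i. d $ i \<noteq> 0"
  shows "torus_act d V \<in> grassmannian k"
  unfolding torus_act_def
  by (rule grassmannian_linear_image[OF linear_vmult assms(1)]) (use assms(2) in \<open>auto simp: vec_eq_iff\<close>)

lemma torus_act_torus_act: "torus_act a (torus_act b V) = torus_act (a * b) V"
  by (simp add: torus_act_def image_image mult.assoc)

lemma torus_act_one: "torus_act 1 V = V"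
  by (simp add: torus_act_def)

lemma torus_nz: "t \<in> torus \<Longrightarrow> t $ i \<noteq> 0"
  by (metis (mono_tags, lifting) mem_Collect_eq norm_zero torus_def zero_neq_one)

lemma torus_mult: "s \<in> torus \<Longrightarrow> t \<in> torus \<Longrightarrow> s * t \<in> torus"
  by (simp add: torus_def norm_mult)

lemma torus_one: "1 \<in> torus"
  by (simp add: torus_def)

lemma torus_cnj: "t \<in> torus \<Longrightarrow> t $ i * cnj (t $ i) = 1"
  by (simp add: torus_def complex_norm_square[symmetric])

lemma torus_inverse:
  assumes "t \<in> torus"
  obtains s where "s \<in> torus" "s * t = 1" "t * s = 1"
proof
  show "(\<chi> i. cnj (t $ i)) \<in> torus" using assms by (simp add: torus_def)
  show "(\<chi> i. cnj (t $ i)) * t = 1" "t * (\<chi> i. cnj (t $ i)) = 1"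
    using torus_cnj[OF assms] by (simp_all add: vec_eq_iff mult.commute)
qed

lemma orbit_eq_iff: "orbit torus V = orbit torus W \<longleftrightarrow> (\<exists>t\<in>torus. W = torus_act t V)"
proof
  assume "orbit torus V = orbit torus W"
  moreover have "W \<in> orbit torus W"
    unfolding orbit_def using torus_one torus_act_one by (metis image_eqI)
  ultimately have "W \<in> orbit torus V" by simp
  then show "\<exists>t\<in>torus. W = torus_act t V" by (auto simp: orbit_def)
next
  assume "\<exists>t\<in>torus. W = torus_act t V"
  then obtain t where t: "t \<in> torus" "W = torus_act t V" by blast
  obtain s where s: "s \<in> torus" "s * t = 1" "t * s = 1" using torus_inverse[OF t(1)] by blast
  show "orbit torus V = orbit torus W"
  proof
    show "orbit torus W \<subseteq> orbit torus V"
      using t torus_mult by (auto simp: orbit_def torus_act_torus_act)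
    show "orbit torus V \<subseteq> orbit torus W"
    proof
      fix U assume "U \<in> orbit torus V"
      then obtain a where a: "a \<in> torus" "U = torus_act a V" by (auto simp: orbit_def)
      have "U = torus_act (a * s) W"
        using a t s by (simp add: torus_act_torus_act mult.assoc)
      then show "U \<in> orbit torus W" using a s torus_mult by (auto simp: orbit_def)
    qed
  qed
qed

text \<open>Multiplication by \<open>t\<close> is unitary, so the projection to the moved subspace
  is the old one conjugated by \<open>t\<close>; the inverse of \<open>t\<close> multiplies the
  coordinate vector by \<open>cnj (t $ j)\<close>.\<close>

lemma oproj_torus_act:
  assumes t: "t \<in> torus" and V: "vec.subspace V" and tV: "vec.subspace (torus_act t V)"
  shows "oproj (torus_act t V) (axis j 1) = cnj (t $ j) *s (t * oproj V (axis j 1))"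
proof (rule oproj_eqI[OF tV])
  have "t * (cnj (t $ j) *s oproj V (axis j 1)) \<in> torus_act t V"
    unfolding torus_act_def using V oproj_in by (intro imageI vec.subspace_scale)
  moreover have "t * (cnj (t $ j) *s oproj V (axis j 1)) = cnj (t $ j) *s (t * oproj V (axis j 1))"
    by (simp add: vec_eq_iff)
  ultimately show "cnj (t $ j) *s (t * oproj V (axis j 1)) \<in> torus_act t V" by simp
  fix w assume "w \<in> torus_act t V"
  then obtain v where v: "v \<in> V" "w = t * v" by (auto simp: torus_act_def)
  have "hip (t * v) (t * y) = hip v y" for y
  proof -
    have "t $ i * v $ i * (cnj (t $ i) * cnj (y $ i)) = v $ i * cnj (y $ i)" for i
    proof -
      have "t $ i * v $ i * (cnj (t $ i) * cnj (y $ i)) = (t $ i * cnj (t $ i)) * (v $ i * cnj (y $ i))"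
        by (simp only: mult_ac)
      then show ?thesis by (simp only: torus_cnj[OF t] mult_1)
    qed
    then show ?thesis by (simp only: hip_def vector_mult_component complex_cnj_mult)
  qed
  then show "hip w (axis j 1) = hip w (cnj (t $ j) *s (t * oproj V (axis j 1)))"
    using v hip_oproj[OF V] by (simp add: hip_scale_right hip_axis_right)
qed

section \<open>The moment map of a coordinate and the flow between its extremal sets\<close>

text \<open>A diagonal entry of the projection matrix, hence smooth in charts and unchanged by
  conjugation with diagonal unitaries. The entry is real, so \<open>Re\<close> loses
  nothing.\<close>

definition moment :: "'n::finite \<Rightarrow> (complex^'n) set \<Rightarrow> real" where
  "moment q V = Re (oproj V (axis q 1) $ q)"

context
  fixes V :: "(complex^'n::finite) set" and q :: 'n
  assumes V: "vec.subspace V"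
begin

lemma hip_oproj_axis: "v \<in> V \<Longrightarrow> hip v (oproj V (axis q 1)) = v $ q"
  using hip_oproj[OF V] by (simp add: hip_axis_right)

lemma hip_oproj_axis_left: "v \<in> V \<Longrightarrow> hip (oproj V (axis q 1)) v = cnj (v $ q)"
  using hip_oproj_axis cnj_hip by metis

lemma oproj_axis_nth: "oproj V (axis q 1) $ q = of_real (moment q V)"
  using hip_oproj_axis[OF oproj_in[OF V, of "axis q 1"]] hip_self_Re[of "oproj V (axis q 1)"]
  by (simp add: moment_def)

lemma moment_nonneg: "0 \<le> moment q V"
  using hip_oproj_axis[OF oproj_in[OF V, of "axis q 1"]] hip_self_nonneg[of "oproj V (axis q 1)"]
  by (simp add: moment_def)

text \<open>Pythagoras for the coordinate vector and its projection. Positivity and definiteness of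
  the form then give the upper bound for the moment and the case of equality.\<close>

lemma hip_axis_minus_oproj:
  "hip (axis q 1 - oproj V (axis q 1)) (axis q 1 - oproj V (axis q 1)) = of_real (1 - moment q V)"
  using hip_oproj_axis[OF oproj_in[OF V, of "axis q 1"]]
  by (simp add: hip_simps hip_axis_left hip_axis_right oproj_axis_nth)

lemma moment_le_1: "moment q V \<le> 1"
  using hip_self_nonneg[of "axis q 1 - oproj V (axis q 1)"] hip_axis_minus_oproj by simp

lemma moment_eq_0_iff: "moment q V = 0 \<longleftrightarrow> V \<subseteq> {z. z $ q = 0}"
proof
  assume "moment q V = 0"
  then have "hip (oproj V (axis q 1)) (oproj V (axis q 1)) = 0"
    using hip_oproj_axis[OF oproj_in[OF V, of "axis q 1"]] oproj_axis_nth by simp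
  then have "oproj V (axis q 1) = 0" by (simp add: hip_self_eq_0)
  then show "V \<subseteq> {z. z $ q = 0}" using hip_oproj_axis by (auto simp: hip_simps)
next
  assume "V \<subseteq> {z. z $ q = 0}"
  then show "moment q V = 0" using oproj_in[OF V, of "axis q 1"] by (auto simp: moment_def)
qed

lemma moment_eq_1_iff: "moment q V = 1 \<longleftrightarrow> axis q 1 \<in> V"
proof
  assume "moment q V = 1"
  then have "axis q 1 - oproj V (axis q 1) = 0"
    using hip_axis_minus_oproj by (simp add: hip_self_eq_0)
  then show "axis q 1 \<in> V" using oproj_in[OF V, of "axis q 1"] by simp
next
  assume "axis q 1 \<in> V"
  then show "moment q V = 1" using oproj_idem[OF V] by (simp add: moment_def)
qed

end

section \<open>Effect of scaling one coordinate on the moment\<close>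

definition dilation :: "'n::finite \<Rightarrow> real \<Rightarrow> complex^'n" where
  "dilation q c = (\<chi> i. if i = q then of_real c else 1)"

lemma dilation_mult: "dilation q c * x = x + ((of_real c - 1) * x $ q) *s axis q 1"
  by (auto simp: dilation_def vec_eq_iff axis_def algebra_simps)

lemma dilation_dilation: "dilation q a * dilation q b = dilation q (a * b)"
  by (auto simp: dilation_def vec_eq_iff)

lemma dilation_1: "dilation q 1 = 1"
  by (auto simp: dilation_def vec_eq_iff)

lemma dilation_nz: "c \<noteq> 0 \<Longrightarrow> dilation q c $ i \<noteq> 0"
  by (simp add: dilation_def)

lemma hip_dilation:
  "hip (dilation q c * x) (dilation q c * y) = hip x y + (of_real c ^ 2 - 1) * (x $ q * cnj (y $ q))"
  by (simp add: dilation_mult hip_simps hip_axis_left hip_axis_right)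
    (simp add: algebra_simps power2_eq_square)

text \<open>For v in \<open>V\<close>, pairing the dilated v with the dilated projection p gives a
  fixed multiple of \<open>v $ q\<close>, and so does pairing it with the coordinate vector. Hence
  the new projection is proportional to the dilated old one.\<close>

lemma moment_dilation:
  assumes V: "vec.subspace V" and dV: "vec.subspace (torus_act (dilation q c) V)" and c: "c \<noteq> 0"
  shows "moment q (torus_act (dilation q c) V) = c\<^sup>2 * moment q V / (1 - moment q V + c\<^sup>2 * moment q V)"
proof -
  define \<nu> where "\<nu> = moment q V"
  define D where "D = 1 - \<nu> + c\<^sup>2 * \<nu>"
  define p where "p = oproj V (axis q 1)"
  have pq: "p $ q = of_real \<nu>" using oproj_axis_nth[OF V] by (simp add: p_def \<nu>_def)
  \<comment> \<open>\<open>D\<close> is the convex combination of 1 and c^2 with weights 1 - \<nu>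
    and \<nu>.\<close>
  have "D > 0"
  proof (cases "\<nu> = 0")
    case False
    then have "\<nu> > 0" "\<nu> \<le> 1"
      using moment_nonneg[OF V, of q] moment_le_1[OF V, of q] by (auto simp: \<nu>_def)
    then have "c\<^sup>2 * \<nu> > 0" "1 - \<nu> \<ge> 0" using c by auto
    then show ?thesis by (simp add: D_def)
  qed (simp add: D_def)
  \<comment> \<open>The ratio of the two multiples of \<open>v $ q\<close>: c from the coordinate
    vector, \<open>D\<close> from the dilated projection.\<close>
  define \<alpha> where "\<alpha> = complex_of_real (c / D)"
  have "oproj (torus_act (dilation q c) V) (axis q 1) = dilation q c * (\<alpha> *s p)"
  proof (rule oproj_eqI[OF dV])
    show "dilation q c * (\<alpha> *s p) \<in> torus_act (dilation q c) V"
      unfolding torus_act_def p_def using V by (intro imageI vec.subspace_scale oproj_in)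
    fix w assume "w \<in> torus_act (dilation q c) V"
    then obtain v where v: "v \<in> V" "w = dilation q c * v" by (auto simp: torus_act_def)
    have "hip w (dilation q c * (\<alpha> *s p)) =
        hip v (\<alpha> *s p) + (of_real c ^ 2 - 1) * (v $ q * cnj ((\<alpha> *s p) $ q))"
      unfolding v(2) by (rule hip_dilation)
    also have "\<dots> = v $ q * (\<alpha> * (1 + (of_real c ^ 2 - 1) * of_real \<nu>))"
    proof -
      have "cnj \<alpha> = \<alpha>" by (simp add: \<alpha>_def)
      moreover have "hip v p = v $ q" using hip_oproj_axis[OF V v(1)] by (simp add: p_def)
      ultimately show ?thesis by (simp add: hip_scale_right pq algebra_simps)
    qed
    also have "1 + (of_real c ^ 2 - 1) * of_real \<nu> = complex_of_real D"
      by (simp add: D_def algebra_simps)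
    also have "\<alpha> * complex_of_real D = of_real c"
      using \<open>D > 0\<close> by (simp add: \<alpha>_def)
    also have "v $ q * of_real c = hip w (axis q 1)"
      by (simp add: v(2) hip_axis_right dilation_def)
    finally show "hip w (axis q 1) = hip w (dilation q c * (\<alpha> *s p))" by simp
  qed
  then have "moment q (torus_act (dilation q c) V) = Re (of_real c * (\<alpha> * of_real \<nu>))"
    by (simp add: moment_def dilation_def pq)
  also have "\<dots> = c\<^sup>2 * \<nu> / D"
    by (simp add: \<alpha>_def power2_eq_square flip: of_real_mult)
  finally show ?thesis by (simp add: D_def \<nu>_def)
qed

lemma moment_torus_act:
  assumes "t \<in> torus" "V \<in> grassmannian k"
  shows "moment q (torus_act t V) = moment q V"
proof -
  have "vec.subspace V" "vec.subspace (torus_act t V)"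
    using assms torus_act_grassmannian[OF assms(2) torus_nz] by (auto simp: grassmannian_def)
  then have "oproj (torus_act t V) (axis q 1) $ q = (t $ q * cnj (t $ q)) * oproj V (axis q 1) $ q"
    using oproj_torus_act[OF assms(1)] by (simp add: mult_ac)
  then show ?thesis by (simp add: moment_def torus_cnj[OF assms(1)])
qed

section \<open>The hypersurface of moment one half and the flow through it\<close>

definition equator :: "'n::finite \<Rightarrow> nat \<Rightarrow> (complex^'n) set set" where
  "equator q k = {V \<in> grassmannian k. moment q V = 1 / 2}"

text \<open>
  If \<open>V = W \<oplus> \<complex>(u + e\<^sub>q)\<close> with \<open>u\<close> a unit vector and \<open>W\<close>, \<open>u\<close>, \<open>e\<^sub>q\<close> pairwise orthogonal, then
  \<open>2 p = u + e\<^sub>q\<close> for the projection \<open>p\<close> of \<open>e\<^sub>q\<close> to \<open>V\<close>, and the time \<open>t\<close> map below sends \<open>V\<close> to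
  \<open>W \<oplus> \<complex>((1 - t) u + t e\<^sub>q)\<close>.
\<close>

definition flow_map :: "'n::finite \<Rightarrow> (complex^'n) set \<Rightarrow> real \<Rightarrow> complex^'n \<Rightarrow> complex^'n" where
  "flow_map q V t v =
    v - v $ q *s ((2 * of_real t) *s oproj V (axis q 1) + (1 - 2 * of_real t) *s axis q 1)"

definition flow :: "'n::finite \<Rightarrow> (complex^'n) set \<Rightarrow> real \<Rightarrow> (complex^'n) set" where
  "flow q V t = flow_map q V t ` V"

lemma linear_flow_map: "Vector_Spaces.linear (*s) (*s) (flow_map q V t)"
  by unfold_locales (auto simp: flow_map_def vec_eq_iff algebra_simps)

context
  fixes V :: "(complex^'n::finite) set" and q :: 'n and k :: nat
  assumes VS: "V \<in> equator q k"
begin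

lemma equator_grassmannian: "V \<in> grassmannian k" and equator_subspace: "vec.subspace V"
  and equator_moment: "moment q V = 1 / 2"
  using VS by (auto simp: equator_def grassmannian_def)

lemma equator_oproj_nth: "oproj V (axis q 1) $ q = 1 / 2"
  using oproj_axis_nth[OF equator_subspace] by (simp add: equator_moment)

lemma flow_map_nth: "flow_map q V t v $ q = of_real t * v $ q"
  by (simp add: flow_map_def equator_oproj_nth algebra_simps)

text \<open>At times other than 0 a kernel vector has vanishing coordinate \<open>q\<close>, and
  such vectors are fixed by the map. At time 0 the kernel is the coordinate line, which meets
  \<open>V\<close> trivially because the moment is not 1.\<close>

lemma flow_grassmannian: "flow q V t \<in> grassmannian k"
  unfolding flow_def
proof (rule grassmannian_linear_image[OF linear_flow_map equator_grassmannian])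
  fix v assume v: "v \<in> V" "flow_map q V t v = 0"
  have "axis q 1 \<notin> V"
    using moment_eq_1_iff[OF equator_subspace, of q] equator_moment by auto
  have "v $ q = 0"
  proof (rule ccontr)
    assume nz: "v $ q \<noteq> 0"
    then have t: "t = 0" using v(2) flow_map_nth[of t v] by simp
    then have "v = v $ q *s axis q 1" using v(2) by (simp add: flow_map_def)
    then have "axis q 1 = inverse (v $ q) *s v"
      using nz by (metis vec.scale_left_imp_eq vec.scale_one vec.scale_scale left_inverse)
    then show False
      using \<open>axis q 1 \<notin> V\<close> v(1) equator_subspace vec.subspace_scale by metis
  qed
  then show "v = 0" using v(2) by (simp add: flow_map_def)
qed

lemma flow_subspace: "vec.subspace (flow q V t)"
  using flow_grassmannian by (auto simp: grassmannian_def)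

text \<open>\<open>flow_map\<close> factors as the dilation after v -> v - 2t v_q p. The second map
  is an automorphism of \<open>V\<close> as long as t is not 1, so it does not affect the image; its
  collapse of p at t = 1 balances the pole of the dilation factor.\<close>

lemma flow_eq_dilation:
  assumes "t < 1"
  shows "flow q V t = torus_act (dilation q (t / (1 - t))) V"
proof -
  define p where "p = oproj V (axis q 1)"
  have pq: "p $ q = 1 / 2" and pV: "p \<in> V"
    using equator_oproj_nth oproj_in[OF equator_subspace] by (auto simp: p_def)
  have t: "complex_of_real (1 - t) \<noteq> 0" using assms by (simp del: of_real_diff)
  have 1: "flow_map q V t v = dilation q (t / (1 - t)) * (v - (2 * of_real t * v $ q) *s p)" for v
  proof -
    have "(of_real (t / (1 - t)) - 1) * (v - (2 * of_real t * v $ q) *s p) $ q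
        = (of_real (t / (1 - t)) - 1) * of_real (1 - t) * v $ q"
    proof -
      have "(v - (2 * of_real t * v $ q) *s p) $ q = of_real (1 - t) * v $ q"
        by (simp add: pq algebra_simps)
      then show ?thesis by (simp only: mult.assoc)
    qed
    also have "\<dots> = (2 * of_real t - 1) * v $ q"
      using t by (simp add: field_simps)
    finally have "((of_real (t / (1 - t)) - 1) * (v - (2 * of_real t * v $ q) *s p) $ q)
        = (2 * of_real t - 1) * v $ q" .
    then show ?thesis
      unfolding dilation_mult flow_map_def
      by (simp add: vec_eq_iff algebra_simps flip: p_def)
  qed
  have "flow q V t = (\<lambda>v. dilation q (t / (1 - t)) * v) ` (\<lambda>v. v - (2 * of_real t * v $ q) *s p) ` V"
    by (simp add: flow_def 1 image_image)
  also have "(\<lambda>v. v - (2 * of_real t * v $ q) *s p) ` V = V"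
  proof
    show "(\<lambda>v. v - (2 * of_real t * v $ q) *s p) ` V \<subseteq> V"
      using pV equator_subspace by (auto intro!: vec.subspace_diff vec.subspace_scale)
    show "V \<subseteq> (\<lambda>v. v - (2 * of_real t * v $ q) *s p) ` V"
    proof
      fix v assume v: "v \<in> V"
      define b where "b = complex_of_real (1 - t)"
      have tb: "complex_of_real t = 1 - b" and "b \<noteq> 0" using t by (simp_all add: b_def)
      \<comment> \<open>The inverse of the automorphism: it divides the coordinate \<open>q\<close>
        by 1 - t, which determines the required multiple of \<open>p\<close>.\<close>
      define w where "w = v + (2 * of_real t * v $ q / b) *s p"
      have wV: "w \<in> V"
        using v pV equator_subspace by (auto simp: w_def intro!: vec.subspace_add vec.subspace_scale)
      have "w $ q = v $ q / b"
        using \<open>b \<noteq> 0\<close> by (simp add: w_def pq tb field_simps)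
      then have "2 * of_real t * w $ q = 2 * of_real t * v $ q / b" by simp
      then have eq: "w - (2 * of_real t * w $ q) *s p = v"
        by (simp only: w_def add_diff_cancel_right')
      show "v \<in> (\<lambda>v. v - (2 * of_real t * v $ q) *s p) ` V"
        by (rule image_eqI[where x = w]) (simp_all only: eq wV)
    qed
  qed
  finally show ?thesis by (simp add: torus_act_def)
qed

lemma moment_flow:
  assumes "0 \<le> t" "t \<le> 1"
  shows "moment q (flow q V t) = t\<^sup>2 / ((1 - t)\<^sup>2 + t\<^sup>2)"
proof -
  \<comment> \<open>The factor t / (1 - t) vanishes at one end and has its pole at the other, so
    \<open>moment_dilation\<close> covers only the interior.\<close>
  consider "t = 0" | "t = 1" | "0 < t" "t < 1" using assms by linarith
  then show ?thesis
  proof cases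
    case 1
    then have "flow q V t \<subseteq> {z. z $ q = 0}"
      using flow_map_nth by (auto simp: flow_def)
    then show ?thesis using 1 moment_eq_0_iff[OF flow_subspace] by simp
  next
    case 2
    \<comment> \<open>Twice the projection has coordinate 1 at \<open>q\<close>, so at time 1 it is
      replaced exactly by the coordinate vector.\<close>
    have "flow_map q V 1 (2 *s oproj V (axis q 1)) = axis q 1"
      by (simp add: flow_map_def equator_oproj_nth vec_eq_iff)
    then have "axis q 1 \<in> flow q V 1"
      unfolding flow_def using oproj_in equator_subspace vec.subspace_scale by (metis image_eqI)
    then show ?thesis using 2 moment_eq_1_iff[OF flow_subspace] by simp
  next
    case 3
    define c where "c = t / (1 - t)"
    have c: "c \<noteq> 0" using 3 by (simp add: c_def)
    have eq: "flow q V t = torus_act (dilation q c) V"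
      using flow_eq_dilation 3 by (simp add: c_def)
    have "moment q (flow q V t) = c\<^sup>2 * (1/2) / (1 - 1/2 + c\<^sup>2 * (1/2))"
      unfolding eq using moment_dilation[OF equator_subspace _ c] flow_subspace[of t]
      by (simp only: eq equator_moment)
    also have "\<dots> = c\<^sup>2 / (1 + c\<^sup>2)" by (simp add: field_simps)
    also have "c\<^sup>2 = t\<^sup>2 / (1 - t)\<^sup>2" by (simp add: c_def power_divide)
    also have "t\<^sup>2 / (1 - t)\<^sup>2 / (1 + t\<^sup>2 / (1 - t)\<^sup>2) = t\<^sup>2 / ((1 - t)\<^sup>2 + t\<^sup>2)"
      using 3 by (simp add: divide_simps)
    finally show ?thesis .
  qed
qed

text \<open>\<open>V\<close> is the orthogonal sum of the line of \<open>p\<close> and its part W in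
  the hyperplane; the flow keeps W and turns the line of \<open>p\<close> into that of
  \<open>r\<close>. So the projection to the first line is removed, with factor 2 because |p|^2 =
  1/2, and the projection to the second is added, with |r|^2 = (1 - t)^2 + t^2. The formula yields
  joint continuity in \<open>V\<close> and t.\<close>

lemma oproj_flow:
  fixes t :: real
  defines "p \<equiv> oproj V (axis q 1)"
  defines "r \<equiv> of_real (1 - t) *s (2 *s p - axis q 1) + of_real t *s axis q 1"
  shows "oproj (flow q V t) x =
    oproj V x - (2 * hip x p) *s p + (hip x r / of_real ((1 - t)\<^sup>2 + t\<^sup>2)) *s r"
proof (rule oproj_eqI[OF flow_subspace])
  have pq: "p $ q = 1 / 2" and pV: "p \<in> V"
    using equator_oproj_nth oproj_in[OF equator_subspace] by (auto simp: p_def)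
  define N where "N = complex_of_real ((1 - t)\<^sup>2 + t\<^sup>2)"
  have N: "N \<noteq> 0"
    unfolding N_def of_real_eq_0_iff by (simp add: sum_power2_eq_zero_iff)
  have hp: "hip v p = v $ q" if "v \<in> V" for v
    using hip_oproj_axis[OF equator_subspace that] by (simp add: p_def)
  have hp': "hip p v = cnj (v $ q)" if "v \<in> V" for v
    using hip_oproj_axis_left[OF equator_subspace that] by (simp add: p_def)
  define w where "w = oproj V x - (2 * hip x p) *s p"
  have "oproj V x $ q = hip x p"
    using hp[OF oproj_in[OF equator_subspace]] hip_oproj[OF equator_subspace pV, of x]
    by (metis cnj_hip)
  then have wq: "w $ q = 0" by (simp add: w_def pq)
  have wV: "w \<in> V"
    unfolding w_def using pV equator_subspace by (intro vec.subspace_diff vec.subspace_scale oproj_in)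
  have r: "flow_map q V t (2 *s p) = r"
    by (simp add: flow_map_def r_def pq vec_eq_iff algebra_simps flip: p_def)
  have "w \<in> flow q V t"
    using wV wq unfolding flow_def by (intro image_eqI[where x = w]) (auto simp: flow_map_def)
  moreover have "r \<in> flow q V t"
    unfolding flow_def using pV equator_subspace vec.subspace_scale r by (metis image_eqI)
  ultimately show "oproj V x - (2 * hip x p) *s p + (hip x r / of_real ((1 - t)\<^sup>2 + t\<^sup>2)) *s r
      \<in> flow q V t"
    unfolding w_def[symmetric] by (intro vec.subspace_add vec.subspace_scale flow_subspace)
  fix y assume "y \<in> flow q V t"
  then obtain v where v: "v \<in> V" "y = flow_map q V t v" by (auto simp: flow_def)
  \<comment> \<open>The component of \<open>v\<close> in the hyperplane part of \<open>V\<close>: 2p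
    has coordinate 1 at \<open>q\<close>.\<close>
  define u where "u = v - (2 * v $ q) *s p"
  have uV: "u \<in> V"
    unfolding u_def using pV v equator_subspace by (intro vec.subspace_diff vec.subspace_scale)
  have uq: "u $ q = 0" by (simp add: u_def pq)
  have y: "y = u + v $ q *s r"
    by (simp add: v(2) flow_map_def r_def u_def vec_eq_iff algebra_simps flip: p_def)
  have hqp: "hip (axis q 1) p = 1 / 2" "hip p (axis q 1) = 1 / 2" "hip p p = 1 / 2"
    using hp[OF pV] by (simp_all add: hip_axis_left hip_axis_right pq)
  have rr: "hip r r = N"
    unfolding r_def N_def hip_simps hqp hip_axis_left axis_nth
    by (simp add: pq field_simps power2_eq_square)
  have ur: "hip a r = 0" "hip r a = 0" if "a \<in> V" "a $ q = 0" for a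
    unfolding r_def hip_simps hip_axis_left hip_axis_right hp[OF that(1)] hp'[OF that(1)]
    using that by simp_all
  have "hip u w = hip u x"
    using hp[OF uV] uq hip_oproj[OF equator_subspace uV] by (simp add: w_def hip_simps)
  then have "hip y (w + (hip x r / N) *s r) = hip u x + v $ q * cnj (hip x r)"
    using N ur[OF uV uq] ur[OF wV wq] by (simp add: y hip_simps rr) (simp add: N_def)
  also have "\<dots> = hip y x"
    by (simp add: y hip_simps cnj_hip)
  finally show "hip y x = hip y (oproj V x - (2 * hip x p) *s p +
      (hip x r / of_real ((1 - t)\<^sup>2 + t\<^sup>2)) *s r)"
    by (simp add: w_def N_def)
qed

lemma torus_act_equator: "t \<in> torus \<Longrightarrow> torus_act t V \<in> equator q k"
  using torus_act_grassmannian[OF equator_grassmannian torus_nz]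
    moment_torus_act[OF _ equator_grassmannian] equator_moment
  by (simp add: equator_def)

text \<open>The phase acquired by \<open>v $ q\<close> cancels against the conjugate phase of the
  moved projection, and \<open>s\<close> acts on the coordinate vector by that same phase; so
  already the linear maps commute with \<open>s\<close>.\<close>

lemma flow_torus_act:
  assumes s: "s \<in> torus"
  shows "flow q (torus_act s V) t = torus_act s (flow q V t)"
proof -
  have sub: "vec.subspace (torus_act s V)"
    using torus_act_equator[OF s] by (auto simp: equator_def grassmannian_def)
  have ax: "s * axis q 1 = s $ q *s axis q 1"
    by (auto simp: vec_eq_iff axis_def)
  have "flow_map q (torus_act s V) t (s * v) = s * flow_map q V t v" for v
  proof -
    have "(s * v) $ q *s ((2 * of_real t) *s (cnj (s $ q) *s (s * oproj V (axis q 1)))) =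
        s * (v $ q *s ((2 * of_real t) *s oproj V (axis q 1)))"
      using torus_cnj[OF s, of q] by (simp add: vec_eq_iff mult_ac)
    moreover have "(s * v) $ q *s ((1 - 2 * of_real t) *s axis q 1) =
        s * (v $ q *s ((1 - 2 * of_real t) *s axis q 1))"
      by (auto simp: vec_eq_iff axis_def algebra_simps)
    ultimately show ?thesis
      unfolding flow_map_def oproj_torus_act[OF s equator_subspace sub]
      by (simp add: vec.scale_right_distrib right_diff_distrib distrib_left)
  qed
  then show ?thesis
    unfolding flow_def torus_act_def by (simp add: image_image)
qed

end

section \<open>Every subspace lies on a flow line or at one of its ends\<close>

lemma equator_exists_flow_0:
  assumes V: "V \<in> grassmannian k" and "1 \<le> k" and 0: "moment q V = 0"
  obtains W where "W \<in> equator q k" "flow q W 0 = V"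
proof -
  have sub: "vec.subspace V" and dim: "vec.dim V = k" using V by (auto simp: grassmannian_def)
  have Vq: "v $ q = 0" if "v \<in> V" for v
    using that 0 moment_eq_0_iff[OF sub] by auto
  have "V \<noteq> {0}" using dim \<open>1 \<le> k\<close> by auto
  then obtain u0 where "u0 \<in> V" "u0 \<noteq> 0" using vec.subspace_0[OF sub] by blast
  then obtain u where u: "u \<in> V" "hip u u = 1"
    using hip_normalize vec.subspace_scale[OF sub] by metis
  \<comment> \<open>Tilts \<open>u\<close> to u + e_q and fixes the orthogonal complement of
    \<open>u\<close> in \<open>V\<close>. Any unit vector of \<open>V\<close> serves.\<close>
  define h where "h = (\<lambda>v. v + hip v u *s axis q 1)"
  have lin: "Vector_Spaces.linear (*s) (*s) h"
    by unfold_locales (auto simp: h_def hip_simps vec_eq_iff algebra_simps)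
  have hq: "h v $ q = hip v u" if "v \<in> V" for v
    using Vq[OF that] by (simp add: h_def)
  have WG: "h ` V \<in> grassmannian k"
  proof (rule grassmannian_linear_image[OF lin V])
    show "v = 0" if "v \<in> V" "h v = 0" for v
    proof -
      have "hip v u = 0" using hq[OF that(1)] unfolding that(2) by simp
      then show ?thesis using that(2) by (simp add: h_def)
    qed
  qed
  then have Wsub: "vec.subspace (h ` V)" by (simp add: grassmannian_def)
  \<comment> \<open>On the tilted subspace, pairing with \<open>h u\<close> gives twice the
    coordinate \<open>q\<close>.\<close>
  have "oproj (h ` V) (axis q 1) = (1 / 2) *s h u"
  proof (rule oproj_eqI[OF Wsub])
    show "(1 / 2) *s h u \<in> h ` V" using Wsub u by (intro vec.subspace_scale) auto
    fix w assume "w \<in> h ` V"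
    then obtain v where v: "v \<in> V" "w = h v" by blast
    have "hip (h v) (h u) = 2 * hip v u"
      using Vq v u by (simp add: h_def hip_simps hip_axis_left hip_axis_right)
    then show "hip w (axis q 1) = hip w ((1 / 2) *s h u)"
      using hq[OF v(1)] by (simp add: v(2) hip_simps hip_axis_right)
  qed
  then have "moment q (h ` V) = 1 / 2"
    using hq[OF u(1)] u(2) by (simp add: moment_def)
  then have E: "h ` V \<in> equator q k" using WG by (simp add: equator_def)
  have "flow_map q (h ` V) 0 (h v) = v" if "v \<in> V" for v
    using hq[OF that] by (simp add: flow_map_def) (simp add: h_def)
  then have "flow q (h ` V) 0 = V" by (simp add: flow_def image_image)
  then show ?thesis using that E by blast
qed

lemma equator_exists_flow_1:
  fixes V :: "(complex^'n::finite) set"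
  assumes V: "V \<in> grassmannian k" and "k < CARD('n)" and 1: "moment q V = 1"
  obtains W where "W \<in> equator q k" "flow q W 1 = V"
proof -
  have sub: "vec.subspace V" and dim: "vec.dim V = k" using V by (auto simp: grassmannian_def)
  have qV: "axis q 1 \<in> V"
    using 1 moment_eq_1_iff[OF sub] by auto
  have "V \<noteq> UNIV" using dim \<open>k < CARD('n)\<close> vec_dim_card[where 'a = complex and 'n = 'n] by auto
  then obtain x where "x \<notin> V" by blast
  define u0 where "u0 = x - oproj V x"
  have "u0 \<noteq> 0" using \<open>x \<notin> V\<close> oproj_in[OF sub, of x] by (auto simp: u0_def)
  have u0V: "hip v u0 = 0" if "v \<in> V" for v
    using hip_oproj[OF sub that] by (simp add: u0_def hip_simps)
  obtain c where c: "hip (c *s u0) (c *s u0) = 1" using hip_normalize[OF \<open>u0 \<noteq> 0\<close>] by blast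
  define u where "u = c *s u0"
  have uV: "hip v u = 0" if "v \<in> V" for v
    using u0V[OF that] by (simp add: u_def hip_simps)
  have uq: "u $ q = 0" using uV[OF qV] by (simp add: hip_axis_left)
  have uV': "hip u v = 0" if "v \<in> V" for v
    using uV[OF that] cnj_hip by (metis complex_cnj_zero)
  have uu: "hip u u = 1" using c by (simp add: u_def)
  \<comment> \<open>The mirror image of the construction for time 0: now e_q lies in
    \<open>V\<close> and is tilted to e_q + u, with \<open>u\<close> a unit normal vector of
    \<open>V\<close>.\<close>
  define h where "h = (\<lambda>v::complex^'n. v + v $ q *s u)"
  have lin: "Vector_Spaces.linear (*s) (*s) h"
    by unfold_locales (auto simp: h_def vec_eq_iff algebra_simps)
  have hq: "h v $ q = v $ q" for v by (simp add: h_def uq)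
  have WG: "h ` V \<in> grassmannian k"
  proof (rule grassmannian_linear_image[OF lin V])
    show "v = 0" if "v \<in> V" "h v = 0" for v
    proof -
      have "v $ q = 0" using hq[of v] unfolding that(2) by simp
      then show ?thesis using that(2) by (simp add: h_def)
    qed
  qed
  then have Wsub: "vec.subspace (h ` V)" by (simp add: grassmannian_def)
  have p: "oproj (h ` V) (axis q 1) = (1 / 2) *s h (axis q 1)"
  proof (rule oproj_eqI[OF Wsub])
    show "(1 / 2) *s h (axis q 1) \<in> h ` V" using Wsub qV by (intro vec.subspace_scale) auto
    fix w assume "w \<in> h ` V"
    then obtain v where v: "v \<in> V" "w = h v" by blast
    have "hip (h v) (h (axis q 1)) = 2 * v $ q"
      using v uq uu uV[OF v(1)] uV'[OF qV] by (simp add: h_def hip_simps hip_axis_left hip_axis_right)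
    then show "hip w (axis q 1) = hip w ((1 / 2) *s h (axis q 1))"
      using hq[of v] by (simp add: v(2) hip_simps hip_axis_right)
  qed
  then have "moment q (h ` V) = 1 / 2"
    using hq[of "axis q 1"] by (simp add: moment_def)
  then have E: "h ` V \<in> equator q k" using WG by (simp add: equator_def)
  have "flow_map q (h ` V) 1 (h v) = v" for v
    by (simp add: flow_map_def p hq) (simp add: h_def vec_eq_iff algebra_simps)
  then have "flow q (h ` V) 1 = V" by (simp add: flow_def image_image)
  then show ?thesis using that E by blast
qed

lemma equator_exists_flow:
  assumes V: "V \<in> grassmannian k" and \<nu>: "0 < moment q V" "moment q V < 1"
  obtains W t where "W \<in> equator q k" "0 < t" "t < 1" "flow q W t = V"
proof -
  define \<nu> where "\<nu> = moment q V"
  \<comment> \<open>Makes c^2 \<nu> equal to 1 - \<nu>, so that the dilated subspace has moment one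
    half.\<close>
  define c where "c = sqrt ((1 - \<nu>) / \<nu>)"
  have c: "c > 0" "c\<^sup>2 = (1 - \<nu>) / \<nu>" using \<nu> by (simp_all add: c_def \<nu>_def)
  define W where "W = torus_act (dilation q c) V"
  have WG: "W \<in> grassmannian k"
    unfolding W_def using c by (intro torus_act_grassmannian[OF V] dilation_nz) auto
  have "moment q W = c\<^sup>2 * \<nu> / (1 - \<nu> + c\<^sup>2 * \<nu>)"
    unfolding W_def \<nu>_def
    by (rule moment_dilation) (use V WG c in \<open>auto simp: grassmannian_def W_def\<close>)
  also have "\<dots> = 1 / 2" using \<nu> by (simp add: c \<nu>_def)
  finally have E: "W \<in> equator q k" using WG by (simp add: equator_def)
  \<comment> \<open>Solves t / (1 - t) = 1 / c, the dilation that leads back to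
    \<open>V\<close>.\<close>
  define t where "t = 1 / (1 + c)"
  have t: "0 < t" "t < 1" using c by (simp_all add: t_def)
  have "t / (1 - t) = 1 / c" using c by (simp add: t_def field_simps)
  then have "flow q W t = torus_act (dilation q (1 / c)) W"
    using flow_eq_dilation[OF E t(2)] by simp
  also have "\<dots> = V"
    using c by (simp add: W_def torus_act_torus_act dilation_dilation dilation_1 torus_act_one)
  finally show ?thesis using that E t by blast
qed

lemma flow_inj:
  assumes V: "V \<in> equator q k" and W: "W \<in> equator q k"
    and t: "0 < t" "t < 1" and eq: "flow q V t = flow q W t"
  shows "V = W"
proof -
  define c where "c = t / (1 - t)"
  have "c \<noteq> 0" using t by (simp add: c_def)
  have "torus_act (dilation q c) V = torus_act (dilation q c) W"
    using eq flow_eq_dilation[OF V t(2)] flow_eq_dilation[OF W t(2)] by (simp add: c_def)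
  then have "torus_act (dilation q (1 / c)) (torus_act (dilation q c) V) =
      torus_act (dilation q (1 / c)) (torus_act (dilation q c) W)" by simp
  then show ?thesis
    using \<open>c \<noteq> 0\<close> by (simp add: torus_act_torus_act dilation_dilation dilation_1 torus_act_one)
qed

text \<open>Since the torus preserves the moment, this recovers the time on a flow line from the
  orbit alone.\<close>

lemma moment_flow_inj:
  fixes s t :: real
  assumes "0 < s" "s < 1" "0 < t" "t < 1"
    and eq: "s\<^sup>2 / ((1 - s)\<^sup>2 + s\<^sup>2) = t\<^sup>2 / ((1 - t)\<^sup>2 + t\<^sup>2)"
  shows "s = t"
proof -
  have "(1 - s)\<^sup>2 + s\<^sup>2 > 0" "(1 - t)\<^sup>2 + t\<^sup>2 > 0"
    using assms by (auto intro!: add_pos_pos)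
  then have "s\<^sup>2 * ((1 - t)\<^sup>2 + t\<^sup>2) = t\<^sup>2 * ((1 - s)\<^sup>2 + s\<^sup>2)"
    using eq by (simp add: frac_eq_eq)
  then have "s\<^sup>2 * (1 - t)\<^sup>2 = t\<^sup>2 * (1 - s)\<^sup>2" by (simp add: algebra_simps)
  then have "(s * (1 - t))\<^sup>2 = (t * (1 - s))\<^sup>2" by (simp only: power_mult_distrib)
  then have "s * (1 - t) = t * (1 - s)"
    using assms by (simp add: power2_eq_iff_nonneg)
  then show ?thesis by (simp add: algebra_simps)
qed

section \<open>Orbits of the torus and of the coordinate subtorus\<close>

lemma moment_orbit:
  assumes "V \<in> grassmannian k" "orbit torus V = orbit torus W"
  shows "moment q V = moment q W"
  using assms moment_torus_act unfolding orbit_eq_iff by metis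

lemma orbit_flow:
  assumes "V \<in> equator q k"
  shows "orbit torus (flow q V t) = (\<lambda>W. flow q W t) ` orbit torus V"
  unfolding orbit_def image_image using flow_torus_act[OF assms] by (intro image_cong) auto

text \<open>The two tori differ in the phase of the coordinate \<open>q\<close>. Changing it moves v
  by a multiple of v_q e_q, which vanishes if \<open>V\<close> lies in the hyperplane and stays in
  \<open>V\<close> if \<open>V\<close> contains e_q.\<close>

lemma orbit_subtorus_eq:
  assumes V: "V \<in> grassmannian k" and m: "moment q V = 0 \<or> moment q V = 1"
  shows "orbit (subtorus q) V = orbit torus V"
proof
  show "orbit (subtorus q) V \<subseteq> orbit torus V" by (auto simp: orbit_def subtorus_def)
  have sub: "vec.subspace V" using V by (simp add: grassmannian_def)
  show "orbit torus V \<subseteq> orbit (subtorus q) V"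
  proof
    fix U assume "U \<in> orbit torus V"
    then obtain t where t: "t \<in> torus" "U = torus_act t V" by (auto simp: orbit_def)
    define s where "s = (\<chi> i. if i = q then 1 else t $ i)"
    have s: "s \<in> subtorus q" using t by (auto simp: s_def subtorus_def torus_def)
    have eq: "t * v = s * (v + ((t $ q - 1) * v $ q) *s axis q 1)"
      and eq': "s * v = t * (v + ((cnj (t $ q) - 1) * v $ q) *s axis q 1)" for v
      using torus_cnj[OF t(1), of q] by (auto simp: vec_eq_iff s_def axis_def algebra_simps)
    have in_V: "v + (c * v $ q) *s axis q 1 \<in> V" if "v \<in> V" for v c
    proof (cases "moment q V = 0")
      case True
      then have "v $ q = 0" using that moment_eq_0_iff[OF sub] by auto
      then show ?thesis using that by simp
    next
      case False
      then have "axis q 1 \<in> V" using m moment_eq_1_iff[OF sub] by auto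
      then show ?thesis using that sub by (intro vec.subspace_add vec.subspace_scale)
    qed
    have "torus_act t V = torus_act s V"
    proof
      show "torus_act t V \<subseteq> torus_act s V"
        unfolding torus_act_def using eq in_V by blast
      show "torus_act s V \<subseteq> torus_act t V"
        unfolding torus_act_def using eq' in_V by blast
    qed
    then show "U \<in> orbit (subtorus q) V" using s t by (auto simp: orbit_def)
  qed
qed

lemma has_derivative_vecI:
  fixes f :: "'a::real_normed_vector \<Rightarrow> 'b::euclidean_space^'n::finite"
  assumes "\<And>i. ((\<lambda>x. f x $ i) has_derivative (\<lambda>h. f' h $ i)) (at x within S)"
  shows "(f has_derivative f') (at x within S)"
  unfolding has_derivative_componentwise_within[of f]
proof
  fix b :: "'b^'n" assume "b \<in> Basis"
  then obtain i u where "b = axis i u" by (auto simp: Basis_vec_def)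
  then show "((\<lambda>x. f x \<bullet> b) has_derivative (\<lambda>x. f' x \<bullet> b)) (at x within S)"
    using has_derivative_inner_left[OF assms[of i], of u] by (simp add: inner_axis)
qed

section \<open>Projections in the graph charts\<close>

text \<open>The conjugate transpose of \<open>Y\<close> times \<open>Y\<close>: the matrix of the
  normal equations for projecting to the column space.\<close>

definition gram :: "complex^'k::finite^'n::finite \<Rightarrow> complex^'k^'k" where
  "gram Y = (\<chi> a b. \<Sum>l\<in>UNIV. cnj (Y $ l $ a) * Y $ l $ b)"

lemma hip_matrix_vector_mult:
  "hip (Y *v z) (Y *v x) = (\<Sum>a\<in>UNIV. z $ a * cnj ((gram Y *v x) $ a))"
proof -
  have "hip (Y *v z) (Y *v x) =
      (\<Sum>l\<in>UNIV. \<Sum>a\<in>UNIV. \<Sum>b\<in>UNIV. z $ a * (Y $ l $ a * cnj (Y $ l $ b) * cnj (x $ b)))"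
    by (simp add: hip_def matrix_vector_mult_def sum_product mult_ac)
  also have "\<dots> = (\<Sum>a\<in>UNIV. \<Sum>b\<in>UNIV. \<Sum>l\<in>UNIV. z $ a * (Y $ l $ a * cnj (Y $ l $ b) * cnj (x $ b)))"
    by (subst sum.swap) (intro sum.cong refl sum.swap)
  also have "\<dots> = (\<Sum>a\<in>UNIV. z $ a * cnj ((gram Y *v x) $ a))"
    by (simp add: gram_def matrix_vector_mult_def sum_distrib_left sum_distrib_right mult_ac)
  finally show ?thesis .
qed

text \<open>A kernel vector x of the Gram matrix satisfies |Yx|^2 = 0.\<close>

lemma det_gram_nz:
  assumes inj: "\<And>x. Y *v x = 0 \<Longrightarrow> x = 0"
  shows "det (gram Y) \<noteq> 0"
proof -
  have "x = 0" if "gram Y *v x = 0" for x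
  proof (rule inj)
    have "hip (Y *v x) (Y *v x) = 0" by (simp add: hip_matrix_vector_mult that)
    then show "Y *v x = 0" by (simp add: hip_self_eq_0)
  qed
  then have "\<exists>B. B ** gram Y = mat 1" by (simp add: matrix_left_invertible_ker)
  then show ?thesis using invertible_left_inverse invertible_det_nz by blast
qed

text \<open>Cramer's rule for the normal equations.\<close>

lemma oproj_range_matrix:
  assumes inj: "\<And>x. Y *v x = 0 \<Longrightarrow> x = 0" and sub: "vec.subspace (range (\<lambda>x. Y *v x))"
  shows "oproj (range (\<lambda>x. Y *v x)) (axis j 1) =
    Y *v (\<chi> i. det (\<chi> a b. if b = i then cnj (Y $ j $ a) else gram Y $ a $ b) / det (gram Y))"
proof (rule oproj_eqI[OF sub])
  define x where "x = (\<chi> i. det (\<chi> a b. if b = i then cnj (Y $ j $ a) else gram Y $ a $ b) / det (gram Y))"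
  have x: "gram Y *v x = (\<chi> a. cnj (Y $ j $ a))"
  proof -
    have "det (gram Y) \<noteq> 0" by (rule det_gram_nz) (rule inj)
    from cramer[OF this, where x = x and b = "\<chi> a. cnj (Y $ j $ a)"] show ?thesis
      unfolding x_def vec_lambda_beta by simp
  qed
  fix w assume "w \<in> range (\<lambda>x. Y *v x)"
  then obtain z where z: "w = Y *v z" by blast
  show "hip w (axis j 1) = hip w (Y *v x)"
    unfolding z hip_matrix_vector_mult x hip_axis_right
    by (simp add: matrix_vector_mult_def mult.commute)
qed simp

text \<open>Up to the order of the rows, the identity matrix stacked on \<open>A\<close>; its
  columns are a basis of the graph.\<close>

definition chart_matrix ::
  "('k::finite \<Rightarrow> 'n::finite) \<Rightarrow> ('m::finite \<Rightarrow> 'n) \<Rightarrow> complex^'k^'m \<Rightarrow> complex^'k^'n" where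
  "chart_matrix \<sigma> \<tau> A = (\<chi> l i. case inv (case_sum \<sigma> \<tau>) l of
     Inl i' \<Rightarrow> if i' = i then 1 else 0 | Inr j \<Rightarrow> A $ j $ i)"

context
  fixes \<sigma> :: "'k::finite \<Rightarrow> 'n::finite" and \<tau> :: "'m::finite \<Rightarrow> 'n"
  assumes bij: "bij (case_sum \<sigma> \<tau>)"
begin

lemma chart_matrix_nth:
  "chart_matrix \<sigma> \<tau> A $ \<sigma> i $ b = (if i = b then 1 else 0)"
  "chart_matrix \<sigma> \<tau> A $ \<tau> j $ b = A $ j $ b"
proof -
  have "inv (case_sum \<sigma> \<tau>) (\<sigma> i) = Inl i" "inv (case_sum \<sigma> \<tau>) (\<tau> j) = Inr j"
    using inv_f_f[OF bij_is_inj[OF bij], of "Inl i"] inv_f_f[OF bij_is_inj[OF bij], of "Inr j"]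
    by simp_all
  then show "chart_matrix \<sigma> \<tau> A $ \<sigma> i $ b = (if i = b then 1 else 0)"
    "chart_matrix \<sigma> \<tau> A $ \<tau> j $ b = A $ j $ b"
    by (simp_all add: chart_matrix_def)
qed

lemma chart_cover: "(\<exists>i. l = \<sigma> i) \<or> (\<exists>j. l = \<tau> j)"
proof -
  obtain s where "l = case_sum \<sigma> \<tau> s" using bij_is_surj[OF bij] by blast
  then show ?thesis by (cases s) auto
qed

lemma chart_matrix_mult_nth:
  "(chart_matrix \<sigma> \<tau> A *v y) $ \<sigma> i = y $ i"
  "(chart_matrix \<sigma> \<tau> A *v y) $ \<tau> j = (A *v y) $ j"
proof -
  have "(if i = b then 1 else 0) * y $ b = (if i = b then y $ b else 0)" for b by simp
  then show "(chart_matrix \<sigma> \<tau> A *v y) $ \<sigma> i = y $ i"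
    by (simp add: matrix_vector_mult_def chart_matrix_nth)
  show "(chart_matrix \<sigma> \<tau> A *v y) $ \<tau> j = (A *v y) $ j"
    by (simp add: matrix_vector_mult_def chart_matrix_nth)
qed

lemma graph_chart_eq_range: "graph_chart \<sigma> \<tau> A = range (\<lambda>y. chart_matrix \<sigma> \<tau> A *v y)"
proof (intro set_eqI iffI)
  fix x assume x: "x \<in> graph_chart \<sigma> \<tau> A"
  have "x $ l = (chart_matrix \<sigma> \<tau> A *v (\<chi> i. x $ \<sigma> i)) $ l" for l
    using chart_cover[of l] x by (auto simp: graph_chart_def chart_matrix_mult_nth vec_eq_iff)
  then show "x \<in> range (\<lambda>y. chart_matrix \<sigma> \<tau> A *v y)" by (metis rangeI vec_eq_iff)
next
  fix x assume "x \<in> range (\<lambda>y. chart_matrix \<sigma> \<tau> A *v y)"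
  then show "x \<in> graph_chart \<sigma> \<tau> A"
    by (auto simp: graph_chart_def chart_matrix_mult_nth vec_eq_iff)
qed

lemma chart_matrix_inj: "chart_matrix \<sigma> \<tau> A *v x = 0 \<Longrightarrow> x = 0"
  using chart_matrix_mult_nth(1)[of A x] by (simp add: vec_eq_iff)

lemma smooth_on_chart_matrix: "smooth_on (\<lambda>A. chart_matrix \<sigma> \<tau> A $ l $ i) UNIV"
proof -
  have "bounded_linear (\<lambda>A :: complex^'k^'m. A $ j $ i)" for j
    using bounded_linear_compose[OF bounded_linear_vec_nth bounded_linear_vec_nth] by blast
  then have "smooth_on (\<lambda>A :: complex^'k^'m. A $ j $ i) UNIV" for j
    using smooth_on_bounded_linear[OF _ open_UNIV smooth_on_id[OF open_UNIV]] by blast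
  then show ?thesis
    by (cases "inv (case_sum \<sigma> \<tau>) l") (simp_all add: chart_matrix_def smooth_on_const)
qed

text \<open>The entries are rational in the entries of \<open>A\<close> and their conjugates, with
  the nonvanishing denominator \<open>det (gram (Y A))\<close>. Conjugation is only real linear, so
  the smoothness is real.\<close>

lemma smooth_on_proj_matrix_chart:
  "smooth_on (\<lambda>A. proj_matrix (graph_chart \<sigma> \<tau> A) $ l $ j) UNIV"
proof -
  define Y where "Y = chart_matrix \<sigma> \<tau>"
  have Y: "smooth_on (\<lambda>A. Y A $ l $ i) UNIV" for l i
    unfolding Y_def by (rule smooth_on_chart_matrix)
  have cY: "smooth_on (\<lambda>A. cnj (Y A $ l $ i)) UNIV" for l i
    by (rule smooth_on_bounded_linear[OF bounded_linear_cnj open_UNIV Y])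
  have g: "smooth_on (\<lambda>A. gram (Y A) $ a $ b) UNIV" for a b
    unfolding gram_def vec_lambda_beta
    by (intro smooth_on_sum smooth_on_mult open_UNIV Y cY)
  have N: "smooth_on (\<lambda>A. (\<chi> a b. if b = i then cnj (Y A $ j $ a) else gram (Y A) $ a $ b) $ a $ b) UNIV"
    for i a b by (cases "b = i") (simp_all add: g cY)
  have "proj_matrix (graph_chart \<sigma> \<tau> A) $ l $ j = (\<Sum>i\<in>UNIV. Y A $ l $ i *
      (det (\<chi> a b. if b = i then cnj (Y A $ j $ a) else gram (Y A) $ a $ b) / det (gram (Y A))))" for A
  proof -
    have "vec.subspace (range (\<lambda>y. Y A *v y))"
      using graph_chart_in_grassmannian[OF bij, of A] graph_chart_eq_range[of A]
      by (simp add: grassmannian_def Y_def)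
    from oproj_range_matrix[OF _ this, of j] show ?thesis
      using chart_matrix_inj[of A]
      by (simp add: proj_matrix_def graph_chart_eq_range matrix_vector_mult_def flip: Y_def)
  qed
  moreover have "smooth_on (\<lambda>A. \<Sum>i\<in>UNIV. Y A $ l $ i *
      (det (\<chi> a b. if b = i then cnj (Y A $ j $ a) else gram (Y A) $ a $ b) / det (gram (Y A)))) UNIV"
    by (intro smooth_on_sum smooth_on_mult smooth_on_divide smooth_on_det open_UNIV Y g N det_gram_nz)
      (simp add: Y_def chart_matrix_inj)
  ultimately show ?thesis by presburger
qed

text \<open>Dilations preserve the range of every chart, so the dilation curve through a point can
  be differentiated in coordinates.\<close>

lemma torus_act_graph_chart:
  assumes d: "\<And>i. d $ i \<noteq> 0"
  shows "torus_act d (graph_chart \<sigma> \<tau> A) = graph_chart \<sigma> \<tau> (\<chi> j i. A $ j $ i * (d $ \<tau> j / d $ \<sigma> i))"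
    (is "_ = graph_chart \<sigma> \<tau> ?B")
proof -
  have eq: "(?B *v (\<chi> i. (d * x) $ \<sigma> i)) $ j = d $ \<tau> j * (A *v (\<chi> i. x $ \<sigma> i)) $ j" for x j
    using d by (simp add: matrix_vector_mult_def sum_distrib_left field_simps)
  have iff: "d * x \<in> graph_chart \<sigma> \<tau> ?B \<longleftrightarrow> x \<in> graph_chart \<sigma> \<tau> A" for x
    unfolding graph_chart_def mem_Collect_eq vec_eq_iff eq using d by simp
  show ?thesis
  proof (intro set_eqI iffI)
    fix y assume y: "y \<in> graph_chart \<sigma> \<tau> ?B"
    define z where "z = (\<chi> i. y $ i / d $ i)"
    have "y = d * z" using d by (simp add: z_def vec_eq_iff)
    then show "y \<in> torus_act d (graph_chart \<sigma> \<tau> A)"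
      unfolding torus_act_def using iff[of z] y by blast
  next
    fix y assume "y \<in> torus_act d (graph_chart \<sigma> \<tau> A)"
    then show "y \<in> graph_chart \<sigma> \<tau> ?B" unfolding torus_act_def using iff by blast
  qed
qed

lemma smooth_on_moment_chart: "smooth_on (\<lambda>A. 2 * moment q (graph_chart \<sigma> \<tau> A) - 1) UNIV"
proof -
  have "smooth_on (\<lambda>A. Re (proj_matrix (graph_chart \<sigma> \<tau> A) $ q $ q)) UNIV"
    by (rule smooth_on_bounded_linear[OF bounded_linear_Re open_UNIV smooth_on_proj_matrix_chart])
  then have "smooth_on (\<lambda>A. moment q (graph_chart \<sigma> \<tau> A)) UNIV"
    by (simp add: proj_matrix_def moment_def)
  then have "smooth_on (\<lambda>A. 2 * moment q (graph_chart \<sigma> \<tau> A) + - 1) UNIV"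
    by (intro smooth_on_add smooth_on_mult smooth_on_const open_UNIV)
  then show ?thesis by simp
qed

text \<open>Along the dilations of a point of the equator, the moment is \<open>c\<^sup>2 / (1 + c\<^sup>2)\<close>.\<close>

lemma moment_chart_derivative_nz:
  assumes a: "graph_chart \<sigma> \<tau> a \<in> equator q k"
  shows "\<exists>v. frechet_derivative (\<lambda>A. 2 * moment q (graph_chart \<sigma> \<tau> A) - 1) (at a) v \<noteq> 0"
proof -
  define f where "f = (\<lambda>A. 2 * moment q (graph_chart \<sigma> \<tau> A) - 1)"
  define \<gamma> :: "real \<Rightarrow> complex^'k^'m" where
    "\<gamma> = (\<lambda>c. \<chi> j i. a $ j $ i * (dilation q c $ \<tau> j / dilation q c $ \<sigma> i))"
  have \<gamma>1: "\<gamma> 1 = a" by (simp add: \<gamma>_def dilation_1 vec_eq_iff)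
  have "(\<lambda>c. dilation q c $ l) differentiable (at 1)" for l
  proof (cases "l = q")
    case True
    have "complex_of_real differentiable (at 1)"
      by (rule bounded_linear_imp_differentiable[OF bounded_linear_of_real])
    then show ?thesis using True by (simp add: dilation_def)
  qed (simp add: dilation_def)
  then have entry: "(\<lambda>c. \<gamma> c $ j $ i) differentiable (at 1)" for i j
    unfolding \<gamma>_def vec_lambda_beta
    by (intro differentiable_mult differentiable_divide differentiable_const) (auto simp: dilation_def)
  define D where "D = (\<lambda>j i. frechet_derivative (\<lambda>c. \<gamma> c $ j $ i) (at 1))"
  have "((\<lambda>c. \<gamma> c $ j $ i) has_derivative D j i) (at 1)" for i j
    unfolding D_def using entry frechet_derivative_works by blast
  then have \<gamma>': "(\<gamma> has_derivative (\<lambda>h. \<chi> j i. D j i h)) (at 1)"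
    by (intro has_derivative_vecI) simp
  have f: "f differentiable (at a)"
    using smooth_on_moment_chart[of q] unfolding f_def smooth_on_def by (metis Cr_on.simps(2) UNIV_I)
  have "((f \<circ> \<gamma>) has_derivative (frechet_derivative f (at a) \<circ> (\<lambda>h. \<chi> j i. D j i h))) (at 1)"
    using diff_chain_at[OF \<gamma>'] f frechet_derivative_works \<gamma>1 by metis
  \<comment> \<open>Along the curve \<open>f\<close> equals (c^2 - 1) / (c^2 + 1), whose derivative
    at c = 1 is exactly 1; the chain rule then exhibits the velocity of the curve as the required
    direction.\<close>
  moreover have "((f \<circ> \<gamma>) has_derivative (\<lambda>h. h)) (at 1)"
  proof (rule has_derivative_transform_within_open[where s = "{0<..}"])
    show "((\<lambda>c::real. (c\<^sup>2 - 1) / (c\<^sup>2 + 1)) has_derivative (\<lambda>h. h)) (at 1)"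
      by (auto intro!: derivative_eq_intros simp: power2_eq_square)
    fix c :: real assume "c \<in> {0<..}"
    then have c: "c \<noteq> 0" by simp
    have V: "graph_chart \<sigma> \<tau> A \<in> grassmannian CARD('k)" for A
      by (rule graph_chart_in_grassmannian[OF bij])
    have "graph_chart \<sigma> \<tau> (\<gamma> c) = torus_act (dilation q c) (graph_chart \<sigma> \<tau> a)"
      unfolding \<gamma>_def by (rule torus_act_graph_chart[symmetric]) (rule dilation_nz[OF c])
    moreover have "vec.subspace (graph_chart \<sigma> \<tau> A)" for A
      using V by (simp add: grassmannian_def)
    moreover have "moment q (graph_chart \<sigma> \<tau> a) = 1 / 2" using a by (simp add: equator_def)
    ultimately have "moment q (graph_chart \<sigma> \<tau> (\<gamma> c)) = c\<^sup>2 * (1/2) / (1 - 1/2 + c\<^sup>2 * (1/2))"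
      using moment_dilation[OF _ _ c, of "graph_chart \<sigma> \<tau> a" q] by metis
    also have "\<dots> = c\<^sup>2 / (1 + c\<^sup>2)" by (simp add: field_simps)
    also have "2 * (c\<^sup>2 / (1 + c\<^sup>2)) - 1 = (c\<^sup>2 - 1) / (c\<^sup>2 + 1)"
    proof -
      have "1 + c\<^sup>2 \<noteq> 0" by (smt (verit) zero_le_power2)
      then show ?thesis by (simp add: field_simps)
    qed
    finally have "2 * moment q (graph_chart \<sigma> \<tau> (\<gamma> c)) - 1 = (c\<^sup>2 - 1) / (c\<^sup>2 + 1)" .
    then show "(c\<^sup>2 - 1) / (c\<^sup>2 + 1) = (f \<circ> \<gamma>) c" by (simp add: f_def)
  qed auto
  ultimately have "frechet_derivative f (at a) \<circ> (\<lambda>h. \<chi> j i. D j i h) = (\<lambda>h. h)"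
    by (rule has_derivative_unique)
  then have "frechet_derivative f (at a) (\<chi> j i. D j i 1) = 1"
    by (metis comp_apply)
  then show ?thesis unfolding f_def by (metis zero_neq_one)
qed

end

lemma smooth_submanifold_equator:
  "smooth_submanifold (grassmannian k)
    (grassmann_atlas :: (complex^'k::finite^'m::finite \<Rightarrow> (complex^'n::finite) set) set) 1 (equator q k)"
  unfolding smooth_submanifold_def
proof (intro conjI ballI allI impI)
  show "equator q k \<subseteq> grassmannian k" by (auto simp: equator_def)
  fix \<phi> :: "complex^'k^'m \<Rightarrow> (complex^'n) set" and a
  assume "\<phi> \<in> grassmann_atlas" and a: "\<phi> a \<in> equator q k"
  then obtain \<sigma> \<tau> where bij: "bij (case_sum \<sigma> \<tau>)" and \<phi>: "\<phi> = graph_chart \<sigma> \<tau>"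
    by (auto simp: grassmann_atlas_def)
  \<comment> \<open>The claim does not tie \<open>k\<close> to the chart type; a chart point on the
    equator forces the equality.\<close>
  have k: "k = CARD('k)"
    using a graph_chart_in_grassmannian[OF bij, of a] by (auto simp: equator_def grassmannian_def \<phi>)
  define f where "f = (\<lambda>A. 2 * moment q (\<phi> A) - 1)"
  have sm: "smooth_on f UNIV" unfolding f_def \<phi> by (rule smooth_on_moment_chart[OF bij])
  obtain v where v: "frechet_derivative f (at a) v \<noteq> 0"
    using moment_chart_derivative_nz[OF bij] a unfolding f_def \<phi> by blast
  have cont: "continuous_on UNIV (\<lambda>x. frechet_derivative f (at x) v)"
    using sm unfolding smooth_on_def by (metis Cr_on.simps)
  \<comment> \<open>Surjectivity of the differential is demanded on a whole neighbourhood; the one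
    direction \<open>v\<close> serves wherever the derivative along it stays nonzero.\<close>
  define U where "U = {x. frechet_derivative f (at x) v \<noteq> 0}"
  have "open U"
    unfolding U_def by (intro open_Collect_neq continuous_on_const cont)
  have "\<exists>w. frechet_derivative f (at x) w = y" if "x \<in> U" for x y
  proof -
    have "f differentiable (at x)"
      using sm unfolding smooth_on_def by (metis Cr_on.simps(2) UNIV_I)
    then have "linear (frechet_derivative f (at x))" by (rule linear_frechet_derivative)
    then have "frechet_derivative f (at x) ((y / frechet_derivative f (at x) v) *\<^sub>R v) = y"
      using that by (simp add: linear_scale U_def)
    then show ?thesis by blast
  qed
  moreover have "smooth_on f U"
  proof -
    have "Cr_on r g UNIV \<Longrightarrow> Cr_on r g U" for r and g :: "complex^'k^'m \<Rightarrow> real"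
      by (induction r arbitrary: g) (auto intro: continuous_on_subset)
    then show ?thesis using sm by (simp add: smooth_on_def)
  qed
  moreover have "\<phi> x \<in> equator q k \<longleftrightarrow> f x = 0" for x
    using graph_chart_in_grassmannian[OF bij, of x] by (auto simp: f_def equator_def k \<phi>)
  ultimately show "\<exists>U. \<exists>f :: nat \<Rightarrow> complex^'k^'m \<Rightarrow> real. open U \<and> a \<in> U \<and>
        (\<forall>i<1. smooth_on (f i) U) \<and>
        (\<forall>x\<in>U. \<forall>y :: nat \<Rightarrow> real. \<exists>v. \<forall>i<1. frechet_derivative (f i) (at x) v = y i) \<and>
        (\<forall>x\<in>U. \<phi> x \<in> equator q k \<longleftrightarrow> (\<forall>i<1. f i x = 0))"
    using \<open>open U\<close> v by (intro exI[of _ U] exI[of _ "\<lambda>i. f"]) (auto simp: U_def)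
qed

section \<open>Compactness of the Grassmannian\<close>

text \<open>Choosing the coordinates \<open>\<sigma>\<close> so that the corresponding maximal minor is largest puts the
  subspace into the polydisc of the chart, by Cramer's rule.\<close>

lemma grassmannian_in_polydisc:
  fixes V :: "(complex^'n::finite) set"
  assumes n: "CARD('n) = CARD('k::finite) + CARD('m::finite)" and V: "V \<in> grassmannian CARD('k)"
  obtains \<sigma> :: "'k::finite \<Rightarrow> 'n" and \<tau> :: "'m::finite \<Rightarrow> 'n" and A
  where "bij (case_sum \<sigma> \<tau>)" "V = graph_chart \<sigma> \<tau> A" "\<And>j i. cmod (A $ j $ i) \<le> 1"
proof -
  obtain \<sigma>0 :: "'k \<Rightarrow> 'n" and \<tau>0 :: "'m \<Rightarrow> 'n" and A0
    where bij0: "bij (case_sum \<sigma>0 \<tau>0)" and V0: "V = graph_chart \<sigma>0 \<tau>0 A0"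
    using V unfolding grassmannian_eq_charts[OF n] grassmann_atlas_def by blast
  define Y where "Y = chart_matrix \<sigma>0 \<tau>0 A0"
  have VY: "V = range (\<lambda>y. Y *v y)"
    unfolding V0 Y_def by (rule graph_chart_eq_range[OF bij0])
  define R where "R = (\<lambda>\<sigma> :: 'k \<Rightarrow> 'n. \<chi> a. Y $ \<sigma> a)"
  define \<mu> where "\<mu> = (\<lambda>\<sigma>. cmod (det (R \<sigma>)))"
  have fin: "finite (range \<mu>)" by simp
  obtain \<sigma> where \<sigma>: "\<mu> \<sigma> = Max (range \<mu>)"
    using Max_in[OF fin] by (metis empty_iff imageE rangeI)
  have max: "\<mu> \<sigma>' \<le> \<mu> \<sigma>" for \<sigma>' unfolding \<sigma> using fin by (intro Max_ge) auto
  \<comment> \<open>The chart in which \<open>V\<close> is first given has minor 1, so the largest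
    minor is nonzero.\<close>
  have "R \<sigma>0 = mat 1"
    unfolding R_def Y_def vec_eq_iff by (simp add: chart_matrix_nth[OF bij0] mat_def)
  then have "\<mu> \<sigma>0 = 1" by (simp add: \<mu>_def)
  then have "\<mu> \<sigma> \<ge> 1" using max[of \<sigma>0] by simp
  then have nz: "det (R \<sigma>) \<noteq> 0" by (auto simp: \<mu>_def)
  have inj: "inj \<sigma>"
  proof (rule injI, rule ccontr)
    fix a b assume "\<sigma> a = \<sigma> b" "a \<noteq> b"
    then have "det (R \<sigma>) = 0"
      by (intro det_identical_rows[of a b]) (auto simp: row_def R_def vec_eq_iff)
    then show False using nz by simp
  qed
  then have "card (- range \<sigma>) = CARD('m)"
    using n by (simp add: Compl_eq_Diff_UNIV card_Diff_subset card_image)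
  then obtain \<tau> :: "'m \<Rightarrow> 'n" where \<tau>: "bij_betw \<tau> UNIV (- range \<sigma>)"
    by (metis finite_class.finite_UNIV finite finite_same_card_bij)
  have bij: "bij (case_sum \<sigma> \<tau>)"
  proof (rule bijI)
    have "\<sigma> i \<noteq> \<tau> j" for i j using \<tau> by (metis ComplD bij_betwE UNIV_I rangeI)
    then show "inj (case_sum \<sigma> \<tau>)"
      using inj \<tau> by (auto simp: inj_on_def bij_betw_def split: sum.splits; metis)
    have "l \<in> range (case_sum \<sigma> \<tau>)" for l
    proof (cases "l \<in> range \<sigma>")
      case True
      then obtain i where "l = case_sum \<sigma> \<tau> (Inl i)" by auto
      then show ?thesis by blast
    next
      case False
      then have "l \<in> range \<tau>" using \<tau> by (simp add: bij_betw_def)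
      then obtain j where "l = case_sum \<sigma> \<tau> (Inr j)" by auto
      then show ?thesis by blast
    qed
    then show "surj (case_sum \<sigma> \<tau>)" by blast
  qed
  obtain B where B: "B ** R \<sigma> = mat 1"
    using nz invertible_det_nz invertible_left_inverse by blast
  define A where "A = (\<chi> j. Y $ \<tau> j) ** B"
  have AR: "A ** R \<sigma> = (\<chi> j. Y $ \<tau> j)"
    by (simp add: A_def B flip: matrix_mul_assoc)
  have "V \<subseteq> graph_chart \<sigma> \<tau> A"
  proof
    fix x assume "x \<in> V"
    then obtain y where y: "x = Y *v y" using VY by blast
    have 1: "(\<chi> i. x $ \<sigma> i) = R \<sigma> *v y" and 2: "(\<chi> j. x $ \<tau> j) = (\<chi> j. Y $ \<tau> j) *v y"
      by (simp_all add: y R_def matrix_vector_mult_def vec_eq_iff)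
    show "x \<in> graph_chart \<sigma> \<tau> A"
      unfolding graph_chart_def mem_Collect_eq 1 2 matrix_vector_mul_assoc AR ..
  qed
  then have eq: "V = graph_chart \<sigma> \<tau> A"
    using V graph_chart_in_grassmannian[OF bij, of A]
    by (intro vec.subspace_dim_equal) (auto simp: grassmannian_def)
  have "cmod (A $ j $ i) \<le> 1" for j i
  proof -
    \<comment> \<open>Exchanging row i for row \<open>\<tau> j\<close> multiplies the minor by
      \<open>A $ j $ i\<close>; maximality bounds this factor by 1.\<close>
    have "(\<Sum>s\<in>UNIV. A $ j $ s *s row s (R \<sigma>)) $ b = (A ** R \<sigma>) $ j $ b" for b
      by (simp add: matrix_matrix_mult_def row_def)
    then have "(\<Sum>s\<in>UNIV. A $ j $ s *s row s (R \<sigma>)) = Y $ \<tau> j"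
      by (simp add: vec_eq_iff AR)
    then have "(\<chi> r. if r = i then (\<Sum>s\<in>UNIV. A $ j $ s *s row s (R \<sigma>)) else row r (R \<sigma>)) =
        R (\<sigma>(i := \<tau> j))"
      by (simp add: vec_eq_iff R_def row_def)
    then have "det (R (\<sigma>(i := \<tau> j))) = A $ j $ i * det (R \<sigma>)"
      using cramer_lemma_transpose[of i "A $ j" "R \<sigma>"] by simp
    then have "cmod (A $ j $ i) * \<mu> \<sigma> \<le> 1 * \<mu> \<sigma>"
      using max[of "\<sigma>(i := \<tau> j)"] by (simp add: \<mu>_def norm_mult)
    then show ?thesis using \<open>\<mu> \<sigma> \<ge> 1\<close> by simp
  qed
  then show ?thesis using that bij eq by blast
qed

lemma compact_polydisc: "compact {A :: complex^'k::finite^'m::finite. \<forall>j i. cmod (A $ j $ i) \<le> 1}"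
  unfolding compact_eq_bounded_closed
proof
  have "norm A \<le> real CARD('m) * real CARD('k)"
    if "\<forall>j i. cmod (A $ j $ i) \<le> 1" for A :: "complex^'k^'m"
  proof -
    have "norm (A $ j) \<le> real CARD('k)" for j
      using L2_set_le_sum[of UNIV "\<lambda>i. norm (A $ j $ i)"] sum_bounded_above[of UNIV "\<lambda>i. norm (A $ j $ i)" 1] that
      by (fastforce simp: norm_vec_def)
    then show ?thesis
      using L2_set_le_sum[of UNIV "\<lambda>j. norm (A $ j)"] sum_bounded_above[of UNIV "\<lambda>j. norm (A $ j)" "real CARD('k)"]
      by (fastforce simp: norm_vec_def)
  qed
  then show "bounded {A :: complex^'k^'m. \<forall>j i. cmod (A $ j $ i) \<le> 1}"
    by (auto simp: bounded_iff)
  show "closed {A :: complex^'k^'m. \<forall>j i. cmod (A $ j $ i) \<le> 1}"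
    by (intro closed_Collect_all closed_Collect_le continuous_intros)
qed

section \<open>Continuity in the topology coherent with the charts\<close>

lemma topspace_atlas_topology:
  assumes "\<And>\<phi> a. \<phi> \<in> \<Phi> \<Longrightarrow> \<phi> a \<in> M"
  shows "topspace (atlas_topology M \<Phi>) = M"
proof
  have "\<phi> -` M = UNIV" if "\<phi> \<in> \<Phi>" for \<phi> using assms that by auto
  then have "openin (atlas_topology M \<Phi>) M" by (simp add: openin_atlas_topology)
  then show "M \<subseteq> topspace (atlas_topology M \<Phi>)" by (rule openin_subset)
  show "topspace (atlas_topology M \<Phi>) \<subseteq> M"
    using openin_topspace[of "atlas_topology M \<Phi>"] unfolding openin_atlas_topology by blast
qed

lemma continuous_map_chart:
  assumes "\<And>\<phi> a. \<phi> \<in> \<Phi> \<Longrightarrow> \<phi> a \<in> M" "\<phi> \<in> \<Phi>"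
  shows "continuous_map euclidean (atlas_topology M \<Phi>) \<phi>"
proof -
  have topspace: "topspace (atlas_topology M \<Phi>) = M"
    by (rule topspace_atlas_topology) (rule assms(1))
  show ?thesis
    unfolding continuous_map_def
  proof (intro conjI allI impI)
    show "\<phi> \<in> topspace euclidean \<rightarrow> topspace (atlas_topology M \<Phi>)"
      using assms by (simp add: topspace)
    fix U assume "openin (atlas_topology M \<Phi>) U"
    then have "open (\<phi> -` U)" using assms(2) by (auto simp: openin_atlas_topology)
    then show "openin euclidean {x \<in> topspace euclidean. \<phi> x \<in> U}" by (simp add: vimage_def)
  qed
qed

lemma continuous_map_from_atlas_topology:
  assumes "\<And>\<phi> a. \<phi> \<in> \<Phi> \<Longrightarrow> \<phi> a \<in> M" "\<And>\<phi>. \<phi> \<in> \<Phi> \<Longrightarrow> continuous_on UNIV (\<lambda>a. f (\<phi> a))"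
  shows "continuous_map (atlas_topology M \<Phi>) euclidean f"
proof -
  have topspace: "topspace (atlas_topology M \<Phi>) = M"
    by (rule topspace_atlas_topology) (rule assms(1))
  show ?thesis
    unfolding continuous_map_def topspace
  proof (intro conjI allI impI)
    fix U :: "'c::topological_space set" assume "openin euclidean U"
    then have "open ((\<lambda>a. f (\<phi> a)) -` U)" if "\<phi> \<in> \<Phi>" for \<phi>
      using assms(2)[OF that] by (simp add: open_vimage)
    moreover have "\<phi> -` {x \<in> M. f x \<in> U} = (\<lambda>a. f (\<phi> a)) -` U" if "\<phi> \<in> \<Phi>" for \<phi>
      using assms(1) that by auto
    ultimately show "openin (atlas_topology M \<Phi>) {x \<in> M. f x \<in> U}"
      by (auto simp: openin_atlas_topology)
  qed auto
qed

section \<open>Gluing along a flow\<close>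

lemma equivclp_invariant:
  assumes "equivclp r x y" "\<And>x y. r x y \<Longrightarrow> Q x = Q y"
  shows "Q x = Q y"
  using assms(1) by (induction rule: equivclp_induct) (auto dest: assms(2))

text \<open>The space \<open>S \<times> [0,1]\<close>, \<open>A\<^sub>0\<close> and \<open>A\<^sub>1\<close> together map onto \<open>G\<close> by a quotient map, since they are
  compact and \<open>G\<close> is Hausdorff. Hence both spaces in question are quotients of this disjoint union,
  and it remains to compare the fibres.\<close>

lemma orbit_space_glued:
  fixes G :: "'a topology" and orb :: "'a \<Rightarrow> 'a set" and F :: "'a \<Rightarrow> real \<Rightarrow> 'a"
  assumes comp: "compact_space G" and haus: "Hausdorff_space G"
    and cl: "closedin G S" "closedin G A0" "closedin G A1"
    and F: "continuous_map (prod_topology (subtopology G S) (top_of_set {0..1})) G (\<lambda>(V, t). F V t)"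
    and orb: "\<And>V t. V \<in> S \<Longrightarrow> t \<in> {0..1} \<Longrightarrow> orb (F V t) = (\<lambda>W. F W t) ` orb V"
    and F0: "\<And>V. V \<in> S \<Longrightarrow> F V 0 \<in> A0" and F1: "\<And>V. V \<in> S \<Longrightarrow> F V 1 \<in> A1"
    and cover: "\<And>V. V \<in> topspace G \<Longrightarrow>
      V \<in> A0 \<or> V \<in> A1 \<or> (\<exists>W\<in>S. \<exists>t. 0 < t \<and> t < 1 \<and> F W t = V)"
    and ends: "\<And>V W. V \<in> A0 \<Longrightarrow> W \<in> A1 \<Longrightarrow> orb V \<noteq> orb W"
    and inner: "\<And>V W t. V \<in> S \<Longrightarrow> 0 < t \<Longrightarrow> t < 1 \<Longrightarrow> W \<in> A0 \<union> A1 \<Longrightarrow> orb (F V t) \<noteq> orb W"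
    and inj: "\<And>V W s t. V \<in> S \<Longrightarrow> W \<in> S \<Longrightarrow> 0 < s \<Longrightarrow> s < 1 \<Longrightarrow> 0 < t \<Longrightarrow> t < 1 \<Longrightarrow>
      orb (F V s) = orb (F W t) \<Longrightarrow> s = t \<and> orb V = orb W"
  shows "quotient_topology G orb homeomorphic_space
    glued_space (quotient_topology (subtopology G S) orb)
      (image (\<lambda>V. F V 0)) (quotient_topology (subtopology G A0) orb)
      (image (\<lambda>V. F V 1)) (quotient_topology (subtopology G A1) orb)"
proof -
  let ?I = "top_of_set {0..1::real}"
  define X where "X = disjoint_union_topology (prod_topology (subtopology G S) ?I)
    (disjoint_union_topology (subtopology G A0) (subtopology G A1))"
  define X' where "X' = disjoint_union_topology (prod_topology (quotient_topology (subtopology G S) orb) ?I)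
    (disjoint_union_topology (quotient_topology (subtopology G A0) orb)
      (quotient_topology (subtopology G A1) orb))"
  have sub: "S \<subseteq> topspace G" "A0 \<subseteq> topspace G" "A1 \<subseteq> topspace G"
    using cl closedin_subset by auto
  have top: "topspace (subtopology G S) = S" "topspace (subtopology G A0) = A0"
    "topspace (subtopology G A1) = A1"
    using sub by auto
  have topX: "topspace X = Inl ` (S \<times> {0..1}) \<union> Inr ` (Inl ` A0 \<union> Inr ` A1)"
    by (simp only: X_def topspace_disjoint_union_topology topspace_prod_topology top topspace_euclidean_subtopology)
  have comp_sub: "compact_space (subtopology G S)" "compact_space (subtopology G A0)"
    "compact_space (subtopology G A1)"
    using comp cl by (auto intro!: compact_space_subtopology closedin_compact_space)
  have compI: "compact_space ?I" by (simp add: compact_space_subtopology)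
  have compX: "compact_space X"
    unfolding X_def using comp_sub compI
    by (intro compact_space_disjoint_union) (simp add: compact_space_prod_topology)
  define R where "R = case_sum (\<lambda>(V, t). F V t) (case_sum (\<lambda>V. V) (\<lambda>V. V))"
  have contR: "continuous_map X G R"
    unfolding X_def R_def
    by (intro continuous_map_case_sum F continuous_map_from_subtopology continuous_map_id[unfolded id_def])
  have "R ` topspace X = topspace G"
  proof
    show "R ` topspace X \<subseteq> topspace G" using continuous_map_image_subset_topspace[OF contR] .
    show "topspace G \<subseteq> R ` topspace X"
    proof
      fix V assume V: "V \<in> topspace G"
      from cover[OF V] consider "V \<in> A0" | "V \<in> A1" | W t where "W \<in> S" "0 < t" "t < 1" "F W t = V"
        by blast
      then show "V \<in> R ` topspace X"
      proof cases
        case 1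
        then have "Inr (Inl V) \<in> topspace X" "R (Inr (Inl V)) = V" by (auto simp: topX R_def)
        then show ?thesis by (metis image_eqI)
      next
        case 2
        then have "Inr (Inr V) \<in> topspace X" "R (Inr (Inr V)) = V" by (auto simp: topX R_def)
        then show ?thesis by (metis image_eqI)
      next
        case 3
        then have "Inl (W, t) \<in> topspace X" "R (Inl (W, t)) = V" by (auto simp: topX R_def)
        then show ?thesis by (metis image_eqI)
      qed
    qed
  qed
  then have "quotient_map X G R"
    using continuous_imp_quotient_map[OF contR compX haus] by blast
  then have q1: "quotient_map X (quotient_topology G orb) (orb \<circ> R)"
    using quotient_map_compose quotient_map_quotient_topology by blast
  define p where "p = map_sum (\<lambda>(V, t :: real). (orb V, t)) (map_sum orb orb)"
  \<comment> \<open>Local compactness of the interval lets the quotient map survive the product with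
    the identity.\<close>
  have "quotient_map (prod_topology (subtopology G S) ?I)
      (prod_topology (quotient_topology (subtopology G S) orb) ?I) (\<lambda>(V, t). (orb V, t))"
    by (rule quotient_map_prod_left[OF compact_imp_locally_compact_space[OF compI]])
      (simp_all add: quotient_map_quotient_topology Hausdorff_space_subtopology)
  then have p: "quotient_map X X' p"
    unfolding X_def X'_def p_def by (intro quotient_map_map_sum quotient_map_quotient_topology)
  define r where "r = glue_rel (topspace (quotient_topology (subtopology G S) orb))
    (image (\<lambda>V. F V 0)) (image (\<lambda>V. F V 1))"
  define c where "c = (\<lambda>z. Collect (equivclp r z))"
  have c_eq: "c z = c w \<longleftrightarrow> equivclp r z w" for z w
    unfolding c_def by (metis Collect_cong equivclp_refl equivclp_sym equivclp_trans mem_Collect_eq)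
  have q2: "quotient_map X (glued_space (quotient_topology (subtopology G S) orb)
      (image (\<lambda>V. F V 0)) (quotient_topology (subtopology G A0) orb)
      (image (\<lambda>V. F V 1)) (quotient_topology (subtopology G A1) orb)) (c \<circ> p)"
    unfolding glued_space_def c_def r_def
    by (rule quotient_map_compose[OF p[unfolded X'_def] quotient_map_quotient_topology])
  \<comment> \<open>The orbit in \<open>G\<close> that a point of the disjoint union represents. It
    is invariant under the generating relation, hence under the generated equivalence.\<close>
  define Q where "Q = case_sum (\<lambda>(O', t). (\<lambda>V. F V t) ` O') (case_sum (\<lambda>O'. O') (\<lambda>O'. O'))"
  have Qp: "Q (p x) = orb (R x)" if "x \<in> topspace X" for x
    using that orb by (auto simp: topX Q_def p_def R_def)
  have Qr: "Q z = Q w" if "equivclp r z w" for z w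
    using that by (rule equivclp_invariant) (auto simp: r_def glue_rel_def Q_def)
  have r_topspace: "topspace (quotient_topology (subtopology G S) orb) = orb ` S"
    by (simp only: topspace_quotient_topology top)
  \<comment> \<open>Normal forms: the ends of the cylinder are pushed into \<open>A0\<close> and
    \<open>A1\<close> by one gluing step. On normal forms the orbit in \<open>G\<close> determines
    the image under \<open>p\<close>, so the generated equivalence never has to be computed.\<close>
  define N where "N = Inl ` (S \<times> {0<..<1::real}) \<union> Inr ` (Inl ` A0 \<union> Inr ` A1)"
  have normal: "\<exists>y\<in>N. equivclp r (p x) (p y)" if x: "x \<in> topspace X" for x
  proof -
    consider V where "x = Inl (V, 0)" "V \<in> S" | V where "x = Inl (V, 1)" "V \<in> S" | "x \<in> N"
      using x by (force simp: topX N_def)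
    then show ?thesis
    proof cases
      case 1
      have "r (p x) (p (Inr (Inl (F V 0))))"
        using 1 orb[of V 0] by (auto simp: r_def glue_rel_def r_topspace p_def)
      moreover have "Inr (Inl (F V 0)) \<in> N" using F0 1 by (simp add: N_def)
      ultimately show ?thesis by blast
    next
      case 2
      have "r (p x) (p (Inr (Inr (F V 1))))"
        using 2 orb[of V 1] by (auto simp: r_def glue_rel_def r_topspace p_def)
      moreover have "Inr (Inr (F V 1)) \<in> N" using F1 2 by (simp add: N_def)
      ultimately show ?thesis by blast
    next
      case 3
      then show ?thesis by (intro bexI[of _ x] equivclp_refl)
    qed
  qed
  have NX: "N \<subseteq> topspace X" by (auto simp: N_def topX)
  have N_inj: "p x = p y" if "x \<in> N" "y \<in> N" "orb (R x) = orb (R y)" for x y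
    using that by (auto simp: N_def R_def p_def ends ends[THEN not_sym] inner inner[THEN not_sym] dest: inj)
  have fib: "(orb \<circ> R) x = (orb \<circ> R) y \<longleftrightarrow> (c \<circ> p) x = (c \<circ> p) y"
    if x: "x \<in> topspace X" and y: "y \<in> topspace X" for x y
  proof
    assume eq: "(orb \<circ> R) x = (orb \<circ> R) y"
    obtain x' y' where x': "x' \<in> N" "equivclp r (p x) (p x')" and y': "y' \<in> N" "equivclp r (p y) (p y')"
      using normal x y by blast
    have "orb (R x') = orb (R x)" "orb (R y') = orb (R y)"
      using Qr[OF x'(2)] Qr[OF y'(2)] Qp x y x'(1) y'(1) NX by (metis subsetD)+
    then have "orb (R x') = orb (R y')" using eq by (simp only: comp_apply)
    then have "p x' = p y'" by (rule N_inj[OF x'(1) y'(1)])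
    then have "equivclp r (p x) (p y)"
      using x'(2) equivclp_sym[OF y'(2)] equivclp_trans by metis
    then show "(c \<circ> p) x = (c \<circ> p) y" by (simp only: comp_apply c_eq)
  next
    assume "(c \<circ> p) x = (c \<circ> p) y"
    then have "equivclp r (p x) (p y)" by (simp only: comp_apply c_eq)
    then have "Q (p x) = Q (p y)" by (rule Qr)
    then show "(orb \<circ> R) x = (orb \<circ> R) y" by (simp only: comp_apply Qp[OF x] Qp[OF y])
  qed
  show ?thesis by (rule quotient_maps_homeomorphic[OF q1 q2 fib])
qed

lemma projection_quotient_topology:
  assumes f: "projection X Y f" and h: "\<And>x. x \<in> topspace X \<Longrightarrow> h (g x) = g' (f x)"
  shows "projection (quotient_topology X g) (quotient_topology Y g') h"
  unfolding projection_def
proof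
  have "continuous_map X (quotient_topology Y g') (g' \<circ> f)"
    using f quotient_imp_continuous_map[OF quotient_map_quotient_topology] continuous_map_compose
    unfolding projection_def by blast
  then have "continuous_map X (quotient_topology Y g') (h \<circ> g)"
    by (rule continuous_map_eq) (simp add: h)
  then show "continuous_map (quotient_topology X g) (quotient_topology Y g') h"
    using continuous_compose_quotient_map_eq[OF quotient_map_quotient_topology] by blast
  have "h ` g ` topspace X = g' ` f ` topspace X"
    unfolding image_image using h by (intro image_cong) auto
  then show "h ` topspace (quotient_topology X g) = topspace (quotient_topology Y g')"
    using f by (simp only: topspace_quotient_topology projection_def)
qed

section \<open>The topology of the Grassmannian\<close>

context
  fixes G :: "(complex^'n::finite) set topology" and \<Phi> :: "(complex^'k::finite^'m::finite \<Rightarrow> (complex^'n) set) set"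
  assumes n: "CARD('n) = CARD('k) + CARD('m)"
  defines "\<Phi> \<equiv> grassmann_atlas"
  defines "G \<equiv> atlas_topology (grassmannian CARD('k)) \<Phi>"
begin

lemma chart_in_grassmannian: "\<phi> \<in> \<Phi> \<Longrightarrow> \<phi> a \<in> grassmannian CARD('k)"
  using graph_chart_in_grassmannian by (auto simp: \<Phi>_def grassmann_atlas_def)

lemma topspace_grassmannian: "topspace G = grassmannian CARD('k)"
  unfolding G_def by (rule topspace_atlas_topology) (rule chart_in_grassmannian)

lemma continuous_map_proj_matrix: "continuous_map G euclidean proj_matrix"
  unfolding G_def
proof (rule continuous_map_from_atlas_topology)
  show "continuous_on UNIV (\<lambda>a. proj_matrix (\<phi> a))" if \<phi>: "\<phi> \<in> \<Phi>" for \<phi>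
  proof -
    obtain \<sigma> \<tau> where "bij (case_sum \<sigma> \<tau>)" "\<phi> = graph_chart \<sigma> \<tau>"
      using \<phi> by (auto simp: \<Phi>_def grassmann_atlas_def)
    then have "continuous_on UNIV (\<lambda>a. proj_matrix (\<phi> a) $ l $ j)" for l j
      using smooth_on_proj_matrix_chart smooth_on_imp_continuous_on by blast
    then have "continuous_on UNIV (\<lambda>a. \<chi> l j. proj_matrix (\<phi> a) $ l $ j)"
      by (intro continuous_on_vec_lambda)
    then show ?thesis by simp
  qed
qed (rule chart_in_grassmannian)

text \<open>There are finitely many charts, and their closed unit polydiscs already cover.\<close>

lemma compact_space_grassmannian: "compact_space G"
proof -
  define K where "K = {A :: complex^'k^'m. \<forall>j i. cmod (A $ j $ i) \<le> 1}"
  have "compactin G (\<phi> ` K)" if "\<phi> \<in> \<Phi>" for \<phi>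
  proof -
    have "continuous_map euclidean G \<phi>"
      unfolding G_def using chart_in_grassmannian that by (rule continuous_map_chart)
    moreover have "compactin euclidean K"
      unfolding K_def compactin_euclidean_iff by (rule compact_polydisc)
    ultimately show ?thesis by (rule image_compactin[rotated])
  qed
  moreover have "finite \<Phi>"
  proof -
    have "\<Phi> \<subseteq> range (\<lambda>(\<sigma>, \<tau>). graph_chart \<sigma> \<tau>)" by (auto simp: \<Phi>_def grassmann_atlas_def)
    then show ?thesis by (rule finite_subset) simp
  qed
  ultimately have "compactin G (\<Union>\<phi>\<in>\<Phi>. \<phi> ` K)"
    by (intro compactin_Union) auto
  moreover have "(\<Union>\<phi>\<in>\<Phi>. \<phi> ` K) = topspace G"
  proof
    show "(\<Union>\<phi>\<in>\<Phi>. \<phi> ` K) \<subseteq> topspace G"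
      using chart_in_grassmannian by (auto simp: topspace_grassmannian)
    show "topspace G \<subseteq> (\<Union>\<phi>\<in>\<Phi>. \<phi> ` K)"
    proof
      fix V assume "V \<in> topspace G"
      then obtain \<sigma> :: "'k \<Rightarrow> 'n" and \<tau> :: "'m \<Rightarrow> 'n" and A
        where "bij (case_sum \<sigma> \<tau>)" "V = graph_chart \<sigma> \<tau> A" "\<And>j i. cmod (A $ j $ i) \<le> 1"
        using grassmannian_in_polydisc[OF n] topspace_grassmannian by metis
      then show "V \<in> (\<Union>\<phi>\<in>\<Phi>. \<phi> ` K)"
        unfolding \<Phi>_def grassmann_atlas_def K_def by blast
    qed
  qed
  ultimately show ?thesis by (simp add: compact_space_def)
qed

lemma inj_on_proj_matrix: "inj_on proj_matrix (topspace G)"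
  unfolding topspace_grassmannian
  by (rule inj_onI, rule proj_matrix_inj) (simp_all add: grassmannian_def)

text \<open>Two subspaces need not lie in a common chart at hand, so points are separated by their
  projection matrices.\<close>

lemma Hausdorff_space_grassmannian: "Hausdorff_space G"
  by (rule Hausdorff_space_injective_preimage[OF _ continuous_map_proj_matrix inj_on_proj_matrix]) simp

lemma embedding_map_proj_matrix: "embedding_map G euclidean proj_matrix"
  by (rule continuous_imp_embedding_map[OF continuous_map_proj_matrix compact_space_grassmannian
        _ inj_on_proj_matrix]) simp

lemma closedin_moment: "closedin G {V \<in> grassmannian CARD('k). moment q V = c}"
proof -
  have "continuous_map G euclidean ((\<lambda>P. Re (P $ q $ q)) \<circ> proj_matrix)"
    by (rule continuous_map_compose[OF continuous_map_proj_matrix])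
      (auto intro!: continuous_intros)
  then have "continuous_map G euclidean (moment q)"
    by (simp add: o_def proj_matrix_def moment_def[abs_def])
  from closedin_continuous_map_preimage[OF this, of "{c}"] show ?thesis
    by (simp add: topspace_grassmannian)
qed

lemma closedin_equator: "closedin G (equator q CARD('k))"
  unfolding equator_def by (rule closedin_moment)

lemma topspace_equator: "topspace (subtopology G (equator q CARD('k))) = equator q CARD('k)"
  using closedin_subset[OF closedin_equator, of q] by auto

lemma continuous_map_flow:
  "continuous_map (prod_topology (subtopology G (equator q CARD('k))) (top_of_set {0..1})) G
    (\<lambda>(V, t). flow q V t)" (is "continuous_map ?X G _")
proof (rule continuous_map_into_embedding[OF embedding_map_proj_matrix])
  define r where "r = (\<lambda>(P :: complex^'n^'n, t :: real) l.
    of_real (1 - t) * (2 * P $ l $ q - axis q 1 $ l) + of_real t * axis q 1 $ l)"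
  \<comment> \<open>The formula of \<open>oproj_flow\<close> read entrywise. It makes sense for
    every matrix, so its continuity can be checked on the full product without mentioning
    subspaces.\<close>
  define H :: "(complex^'n^'n) \<times> real \<Rightarrow> complex^'n^'n" where
    "H = (\<lambda>z. \<chi> l j. fst z $ l $ j - 2 * cnj (fst z $ j $ q) * fst z $ l $ q
      + cnj (r z j) / of_real ((1 - snd z)\<^sup>2 + (snd z)\<^sup>2) * r z l)"
  have "complex_of_real ((1 - t)\<^sup>2 + t\<^sup>2) \<noteq> 0" for t
    unfolding of_real_eq_0_iff by (simp add: sum_power2_eq_zero_iff)
  moreover have "continuous_on UNIV (\<lambda>z. r z l)" for l
    unfolding r_def split_def by (intro continuous_intros)
  ultimately have "continuous_on UNIV H"
    unfolding H_def by (intro continuous_intros) auto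
  moreover have "continuous_map ?X (prod_topology euclidean euclidean) (\<lambda>z. (proj_matrix (fst z), snd z))"
    using continuous_map_compose[OF continuous_map_fst continuous_map_from_subtopology[OF continuous_map_proj_matrix]]
      continuous_map_into_fulltopology[OF continuous_map_snd]
    by (intro continuous_map_pairedI) (auto simp: o_def)
  ultimately have "continuous_map ?X euclidean (H \<circ> (\<lambda>z. (proj_matrix (fst z), snd z)))"
    by (intro continuous_map_compose) auto
  then show "continuous_map ?X euclidean (proj_matrix \<circ> (\<lambda>(V, t). flow q V t))"
  proof (rule continuous_map_eq)
    fix z assume z: "z \<in> topspace ?X"
    obtain V t where Vt: "z = (V, t)" by fastforce
    with z have V: "V \<in> equator q CARD('k)" by simp
    show "(H \<circ> (\<lambda>z. (proj_matrix (fst z), snd z))) z = (proj_matrix \<circ> (\<lambda>(V, t). flow q V t)) z"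
      unfolding Vt o_def vec_eq_iff
      by (simp only: H_def r_def proj_matrix_def oproj_flow[OF V] hip_axis_left vec_lambda_beta
          prod.case fst_conv snd_conv vector_add_component vector_minus_component
          vector_smult_component simp_thms)
  qed
  show "(\<lambda>(V, t). flow q V t) \<in> topspace ?X \<rightarrow> topspace G"
    using flow_grassmannian by (auto simp: topspace_grassmannian topspace_equator)
qed

lemma continuous_map_flow_at:
  assumes "t \<in> {0..1}"
  shows "continuous_map (subtopology G (equator q CARD('k))) G (\<lambda>V. flow q V t)"
proof -
  have "continuous_map (subtopology G (equator q CARD('k)))
      (prod_topology (subtopology G (equator q CARD('k))) (top_of_set {0..1})) (\<lambda>V. (V, t))"
    using assms by (intro continuous_map_pairedI continuous_map_id[unfolded id_def]) auto
  from continuous_map_compose[OF this continuous_map_flow] show ?thesis by (simp add: o_def)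
qed

text \<open>The moment yields equality of the times; equivariance then moves the torus element
  inside the flow, where injectivity at a fixed interior time applies.\<close>

lemma orbit_flow_inj:
  assumes V: "V \<in> equator q CARD('k)" and W: "W \<in> equator q CARD('k)"
    and s: "0 < s" "s < 1" and t: "0 < t" "t < 1"
    and eq: "orbit torus (flow q V s) = orbit torus (flow q W t)"
  shows "s = t \<and> orbit torus V = orbit torus W"
proof -
  have "moment q (flow q V s) = moment q (flow q W t)"
    by (rule moment_orbit[OF flow_grassmannian[OF V] eq])
  then have st: "s = t"
    using moment_flow_inj s t moment_flow[OF V] moment_flow[OF W] by simp
  obtain u where u: "u \<in> torus" "flow q W t = torus_act u (flow q V t)"
    using eq st by (auto simp: orbit_eq_iff)
  then have "flow q W t = flow q (torus_act u V) t" using flow_torus_act[OF V] by simp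
  then have "W = torus_act u V"
    using flow_inj[OF W torus_act_equator[OF V u(1)] t] by simp
  then show ?thesis using st u(1) by (auto simp: orbit_eq_iff)
qed

end

theorem theorem1p4:
  fixes q :: "'n::finite" and k :: nat
    and \<Phi> :: "(complex^('k::finite)^('m::finite) \<Rightarrow> (complex^'n) set) set"
    and G G0 G1 :: "(complex^'n) set topology"
  assumes "1 \<le> k" and "k \<le> CARD('n) - 1"
    and "CARD('k) = k" and "CARD('m) = CARD('n) - k"
  defines "\<Phi> \<equiv> grassmann_atlas"
  defines "G \<equiv> atlas_topology (grassmannian k) \<Phi>"
  defines "G0 \<equiv> subtopology G {V \<in> grassmannian k. V \<subseteq> {z. z $ q = 0}}"
  defines "G1 \<equiv> subtopology G {V \<in> grassmannian k. axis q 1 \<in> V}"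
  shows "\<exists>S \<pi>0 \<pi>1 \<pi>0h \<pi>1h.
    smooth_submanifold (grassmannian k) \<Phi> 1 S \<and> closedin G S \<and> compactin G S \<and>
    (\<forall>t\<in>torus. \<forall>V\<in>S. torus_act t V \<in> S) \<and>
    projection (subtopology G S) G0 \<pi>0 \<and> torus_equivariant_on S \<pi>0 \<and>
    projection (subtopology G S) G1 \<pi>1 \<and> torus_equivariant_on S \<pi>1 \<and>
    projection (orbit_space (subtopology G S) torus) (orbit_space G0 (subtorus q)) \<pi>0h \<and>
    (\<forall>V\<in>S. \<pi>0h (orbit torus V) = orbit (subtorus q) (\<pi>0 V)) \<and>
    projection (orbit_space (subtopology G S) torus) (orbit_space G1 (subtorus q)) \<pi>1h \<and>
    (\<forall>V\<in>S. \<pi>1h (orbit torus V) = orbit (subtorus q) (\<pi>1 V)) \<and>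
    orbit_space G torus homeomorphic_space
      glued_space (orbit_space (subtopology G S) torus)
        \<pi>0h (orbit_space G0 (subtorus q))
        \<pi>1h (orbit_space G1 (subtorus q))"
proof -
  have k: "k = CARD('k)" and n: "CARD('n) = CARD('k) + CARD('m)" and kn: "k < CARD('n)"
    using assms(1-4) by auto
  have G: "G = atlas_topology (grassmannian CARD('k))
      (grassmann_atlas :: (complex^'k^'m \<Rightarrow> (complex^'n) set) set)"
    by (simp add: G_def \<Phi>_def k)
  define S where "S = equator q k"
  \<comment> \<open>As moment levels both extremal sets are indexed by the end time c in {0, 1}, so
    one argument serves both ends.\<close>
  define A where "A = (\<lambda>c. {V \<in> grassmannian k. moment q V = c})"
  define \<pi> where "\<pi> = (\<lambda>t V. flow q V t)"
  have A0: "{V \<in> grassmannian k. V \<subseteq> {z. z $ q = 0}} = A 0"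
    and A1: "{V \<in> grassmannian k. axis q 1 \<in> V} = A 1"
    using moment_eq_0_iff[of _ q] moment_eq_1_iff[of _ q] by (auto simp: A_def grassmannian_def)
  have topG: "topspace G = grassmannian k"
    unfolding G k by (rule topspace_grassmannian[OF n])
  have clA: "closedin G (A c)" for c unfolding A_def G k by (rule closedin_moment[OF n])
  have clS: "closedin G S" unfolding S_def G k by (rule closedin_equator[OF n])
  have compG: "compact_space G" unfolding G by (rule compact_space_grassmannian[OF n])
  have hausG: "Hausdorff_space G" unfolding G by (rule Hausdorff_space_grassmannian[OF n])
  have topS: "topspace (subtopology G S) = S" and topA: "topspace (subtopology G (A c)) = A c" for c
    using closedin_subset[OF clS] closedin_subset[OF clA] by auto
  have inv: "torus_act t V \<in> S" if "t \<in> torus" "V \<in> S" for t V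
    using torus_act_equator that by (simp add: S_def)
  have flow_ends: "flow q V c \<in> A c" if "V \<in> S" "c \<in> {0, 1}" for V c
    using flow_grassmannian[of V q k c] moment_flow[of V q k c] that by (auto simp: A_def S_def)
  have proj: "projection (subtopology G S) (subtopology G (A c)) (\<pi> c)" if c: "c \<in> {0, 1}" for c
    unfolding projection_def topS topA
  proof
    have "continuous_map (subtopology G S) G (\<pi> c)"
      unfolding S_def G k \<pi>_def using c by (intro continuous_map_flow_at[OF n]) auto
    then show "continuous_map (subtopology G S) (subtopology G (A c)) (\<pi> c)"
      using flow_ends c by (auto simp: continuous_map_in_subtopology topS \<pi>_def)
    show "\<pi> c ` S = A c"
    proof
      show "\<pi> c ` S \<subseteq> A c" using flow_ends c by (auto simp: \<pi>_def)
      have "\<exists>W\<in>S. flow q W c = V" if V: "V \<in> A c" for V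
      proof (cases "c = 0")
        case True
        obtain W where "W \<in> equator q k" "flow q W 0 = V"
          by (rule equator_exists_flow_0[of V k q]) (use V True assms(1) in \<open>auto simp: A_def\<close>)
        then show ?thesis using True by (auto simp: S_def)
      next
        case False
        then have c1: "c = 1" using c by simp
        obtain W where "W \<in> equator q k" "flow q W 1 = V"
          by (rule equator_exists_flow_1[of V k q]) (use V c1 kn in \<open>auto simp: A_def\<close>)
        then show ?thesis using c1 by (auto simp: S_def)
      qed
      then show "A c \<subseteq> \<pi> c ` S" by (auto simp: \<pi>_def)
    qed
  qed
  have equi: "torus_equivariant_on S (\<pi> c)" for c
    by (simp add: torus_equivariant_on_def \<pi>_def S_def flow_torus_act)
  have sub_orbit: "orbit (subtorus q) V = orbit torus V" if "V \<in> A c" "c \<in> {0, 1}" for V c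
    using that orbit_subtorus_eq[of V k q] by (auto simp: A_def)
  \<comment> \<open>Orbits are sets of subspaces, so the map induced by an equivariant map is taking
    images.\<close>
  have hat: "image (\<pi> c) (orbit torus V) = orbit (subtorus q) (\<pi> c V)" if "V \<in> S" "c \<in> {0, 1}" for V c
    using sub_orbit[OF flow_ends[OF that]] orbit_flow[OF that(1)[unfolded S_def], of c] that(2)
    unfolding \<pi>_def by simp
  \<comment> \<open>The gluing lemma works with a single orbit map; on the extremal sets full torus
    and subtorus have the same orbits.\<close>
  have orb_A: "orbit_space (subtopology G (A c)) (subtorus q) =
      quotient_topology (subtopology G (A c)) (orbit torus)" if "c \<in> {0, 1}" for c
    unfolding orbit_space_def by (rule quotient_topology_cong) (use sub_orbit that topA in auto)
  have proj_hat: "projection (orbit_space (subtopology G S) torus)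
      (orbit_space (subtopology G (A c)) (subtorus q)) (image (\<pi> c))" if "c \<in> {0, 1}" for c
    unfolding orbit_space_def
    by (rule projection_quotient_topology[OF proj[OF that]]) (use hat that topS in auto)
  have "quotient_topology G (orbit torus) homeomorphic_space
    glued_space (quotient_topology (subtopology G S) (orbit torus))
      (image (\<lambda>V. flow q V 0)) (quotient_topology (subtopology G (A 0)) (orbit torus))
      (image (\<lambda>V. flow q V 1)) (quotient_topology (subtopology G (A 1)) (orbit torus))"
  proof (rule orbit_space_glued[OF compG hausG clS clA clA])
    show "continuous_map (prod_topology (subtopology G S) (top_of_set {0..1})) G (\<lambda>(V, t). flow q V t)"
      unfolding S_def G k by (rule continuous_map_flow[OF n])
    show "orbit torus (flow q V t) = (\<lambda>W. flow q W t) ` orbit torus V" if "V \<in> S" for V t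
      using that unfolding S_def by (rule orbit_flow)
    show "flow q V 0 \<in> A 0" "flow q V 1 \<in> A 1" if "V \<in> S" for V
      using flow_ends that by auto
    show "V \<in> A 0 \<or> V \<in> A 1 \<or> (\<exists>W\<in>S. \<exists>t. 0 < t \<and> t < 1 \<and> flow q W t = V)"
      if "V \<in> topspace G" for V
    proof -
      have V: "V \<in> grassmannian k" using that topG by simp
      then have "0 \<le> moment q V" "moment q V \<le> 1"
        using moment_nonneg moment_le_1 by (auto simp: grassmannian_def)
      then consider "moment q V = 0" | "moment q V = 1" | "0 < moment q V" "moment q V < 1" by linarith
      then show ?thesis
      proof cases
        case 3
        then show ?thesis using equator_exists_flow[OF V] by (metis S_def)
      qed (use V in \<open>auto simp: A_def\<close>)
    qed
    show "orbit torus V \<noteq> orbit torus W" if "V \<in> A 0" "W \<in> A 1" for V W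
      using that moment_orbit[of V k W q] by (auto simp: A_def)
    show "orbit torus (flow q V t) \<noteq> orbit torus W"
      if V: "V \<in> S" and t: "0 < t" "t < 1" and W: "W \<in> A 0 \<union> A 1" for V W t
    proof
      assume eq: "orbit torus (flow q V t) = orbit torus W"
      have "moment q W = t\<^sup>2 / ((1 - t)\<^sup>2 + t\<^sup>2)"
        using moment_orbit[OF flow_grassmannian eq] moment_flow[of V q k t] V t by (simp add: S_def)
      moreover have pos: "0 < t\<^sup>2" "0 < (1 - t)\<^sup>2" using t by auto
      ultimately have "0 < moment q W" by (simp only: divide_pos_pos add_pos_pos)
      moreover have "t\<^sup>2 / ((1 - t)\<^sup>2 + t\<^sup>2) < 1"
        unfolding divide_less_eq_1_pos[OF add_pos_pos[OF pos(2,1)]] using pos by linarith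
      ultimately have "0 < moment q W" "moment q W < 1"
        using \<open>moment q W = _\<close> by simp_all
      then show False using W by (auto simp: A_def)
    qed
    show "s = t \<and> orbit torus V = orbit torus W"
      if "V \<in> S" "W \<in> S" "0 < s" "s < 1" "0 < t" "t < 1"
        "orbit torus (flow q V s) = orbit torus (flow q W t)" for V W s t
      using orbit_flow_inj[OF n] that by (simp add: S_def k)
  qed
  then have homeo: "orbit_space G torus homeomorphic_space
      glued_space (orbit_space (subtopology G S) torus)
        (image (\<pi> 0)) (orbit_space (subtopology G (A 0)) (subtorus q))
        (image (\<pi> 1)) (orbit_space (subtopology G (A 1)) (subtorus q))"
    using orb_A[of 0] orb_A[of 1] by (simp add: orbit_space_def \<pi>_def)
  have smooth: "smooth_submanifold (grassmannian k) \<Phi> 1 S"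
    unfolding \<Phi>_def S_def by (rule smooth_submanifold_equator)
  have compS: "compactin G S" by (rule closedin_compact_space[OF compG clS])
  show ?thesis
    unfolding G0_def G1_def A0 A1
    using smooth clS compS inv proj equi proj_hat hat homeo
    by (intro exI[of _ S] exI[of _ "\<pi> 0"] exI[of _ "\<pi> 1"] exI[of _ "image (\<pi> 0)"] exI[of _ "image (\<pi> 1)"]) simp
qed

end
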